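(* Let $R$ be an indecomposable, reduced, crystallographic root system in a finite-dimensional Euclidean vector space $\mathfrak a$, with reflection group $W$, let $k\ge 0$ be a nonnegative multiplicity function on $R$, and let $V=V_k$ be Dunkl's intertwining operator associated with $R$ and $k$. Then for each $x\in\mathfrak a$ there exists a unique probability measure $\mu_x\in M^1(\mathfrak a)$ such that $$Vf(x)=\int_{\mathfrak a} f(\xi)\,d\mu_x(\xi)\qquad\text{for all } f\in A_{|x|}.$$ The support of $\mu_x$ is contained in $C(x)$.
   Context: Let $\mathfrak a$ be a finite-dimensional Euclidean vector space with inner product $\langle\cdot,\cdot\rangle$ and norm $|\cdot|$. For $\alpha\in\mathfrak a\setminus\{0\}$ put $\alpha^\vee=\frac{2\alpha}{\langle\alpha,\alpha\rangle}$ and $\sigma_\alpha(x)=x-\langle x,\alpha^\vee\rangle\alpha$. Root system: $R\subset\mathfrak a\setminus\{0\}$ is a finite set which spans $\mathfrak a$ and satisfies $\sigma_\alpha(R)=R$ and $\langle\alpha,\beta^\vee\rangle\in\mathbb Z$ for all $\alpha,\beta\in R$ (crystallographic), $R\cap\mathbb R\alpha=\{\pm\alpha\}$ for all $\alpha\in R$ (reduced), and $R$ is indecomposable (not a disjoint union of two nonempty mutually orthogonal subsets). $W$ is the finite reflection group generated by the $\sigma_\alpha$, $\alpha\in R$. Fix a positive subsystem $R_+$ of $R$. A nonnegative multiplicity function is a family $k=(k_\alpha)_{\alpha\in R}$ with $k_\alpha\ge 0$ and $k_\alpha=k_\beta$ whenever $\alpha,\beta$ lie in the same $W$-orbit. Dunkl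 operators and intertwiner: $\mathcal P=\mathbb C[\mathfrak a]$ is the space of complex polynomial functions on $\mathfrak a$ and $\mathcal P_n\subset\mathcal P$ the subspace of polynomials homogeneous of degree $n\in\mathbb Z_+=\{0,1,2,\dots\}$. For $\xi\in\mathfrak a$ the rational Dunkl operator is $$T_\xi=\partial_\xi+\sum_{\alpha\in R_+}k_\alpha\langle\alpha,\xi\rangle\frac{1}{\langle\alpha,\cdot\rangle}(1-\sigma_\alpha),$$ where $\sigma_\alpha$ acts on functions by $(\sigma_\alpha f)(x)=f(\sigma_\alpha x)$. There is a unique linear isomorphism $V=V_k$ of $\mathcal P$ (Dunkl's intertwining operator) with $V(1)=1$, $V(\mathcal P_n)=\mathcal P_n$ for all $n$, and $T_\xi V=V\partial_\xi$ for all $\xi\in\mathfrak a$. Extension of $V$: for $r>0$ let $K_r=\{x\in\mathfrak a:|x|\le r\}$ and $$A_r=\Big\{f:K_r\to\mathbb C,\ f=\sum_{n=0}^\infty f_n\ \text{with } f_n\in\mathcal P_n\ \text{and}\ \|f\|_{A_r}:=\sum_{n=0}^\infty\|f_n\|_{\infty,K_r}<\infty\Big\},$$ where $\|f_n\|_{\infty,K_r}=\sup_{x\in K_r}|f_n(x)|$. $V$ extends to a continuous linear operator on the Banach space $(A_r,\|\cdot\|_{A_r})$ by $V\big(\sum_{n}f_n\big):=\sum_{n}Vf_n$. For $x=0$, the same definitions are used with $r=0$, $K_0=\{0\}$, so that $Vf(0)=f(0)$. Since $f\in A_{|x|}$ is defined only on $K_{|x|}$, the integral over $\mathfrak a$ is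 understood for measures concentrated on $K_{|x|}$. $C(x)$ denotes the closure of the convex hull of the orbit $Wx$ in $\mathfrak a$ (so $C(x)\subset K_{|x|}$), and $M^1(X)$ denotes the set of probability measures on the Borel $\sigma$-algebra of a locally compact Hausdorff space $X$. *)

theory Defs
  imports "HOL-Probability.Probability_Measure"
begin

section \<open>Root systems\<close>

definition coroot :: "'a::euclidean_space \<Rightarrow> 'a" where
  "coroot \<alpha> = (2 / (\<alpha> \<bullet> \<alpha>)) *\<^sub>R \<alpha>"

definition refl_in :: "'a::euclidean_space \<Rightarrow> 'a \<Rightarrow> 'a" where
  "refl_in \<alpha> x = x - (x \<bullet> coroot \<alpha>) *\<^sub>R \<alpha>"

definition root_system :: "'a::euclidean_space set \<Rightarrow> bool" where
  "root_system R \<longleftrightarrow>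
     finite R \<and> 0 \<notin> R \<and> span R = UNIV \<and>
     (\<forall>\<alpha>\<in>R. refl_in \<alpha> ` R = R)"

definition crystallographic :: "'a::euclidean_space set \<Rightarrow> bool" where
  "crystallographic R \<longleftrightarrow> (\<forall>\<alpha>\<in>R. \<forall>\<beta>\<in>R. \<alpha> \<bullet> coroot \<beta> \<in> \<int>)"

definition reduced_roots :: "'a::euclidean_space set \<Rightarrow> bool" where
  "reduced_roots R \<longleftrightarrow> (\<forall>\<alpha>\<in>R. R \<inter> range (\<lambda>c. c *\<^sub>R \<alpha>) = {\<alpha>, - \<alpha>})"

definition indecomposable :: "'a::euclidean_space set \<Rightarrow> bool" where
  "indecomposable R \<longleftrightarrow>
     \<not> (\<exists>A B. A \<noteq> {} \<and> B \<noteq> {} \<and> A \<inter> B = {} \<and> A \<union> B = R \<and>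
            (\<forall>\<alpha>\<in>A. \<forall>\<beta>\<in>B. \<alpha> \<bullet> \<beta> = 0))"

definition positive_subsystem :: "'a::euclidean_space set \<Rightarrow> 'a set \<Rightarrow> bool" where
  "positive_subsystem R P \<longleftrightarrow>
     (\<exists>v. (\<forall>\<alpha>\<in>R. \<alpha> \<bullet> v \<noteq> 0) \<and> P = {\<alpha> \<in> R. \<alpha> \<bullet> v > 0})"

inductive_set refl_group :: "'a::euclidean_space set \<Rightarrow> ('a \<Rightarrow> 'a) set"
  for R :: "'a set" where
  id: "id \<in> refl_group R"
| refl: "\<alpha> \<in> R \<Longrightarrow> refl_in \<alpha> \<in> refl_group R"
| comp: "v \<in> refl_group R \<Longrightarrow> w \<in> refl_group R \<Longrightarrow> v \<circ> w \<in> refl_group R"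
| inv: "w \<in> refl_group R \<Longrightarrow> inv w \<in> refl_group R"

definition weyl_orbit :: "'a::euclidean_space set \<Rightarrow> 'a \<Rightarrow> 'a set" where
  "weyl_orbit R x = {w x | w. w \<in> refl_group R}"

definition nonneg_multiplicity :: "'a::euclidean_space set \<Rightarrow> ('a \<Rightarrow> real) \<Rightarrow> bool" where
  "nonneg_multiplicity R k \<longleftrightarrow>
     (\<forall>\<alpha>\<in>R. k \<alpha> \<ge> 0) \<and> (\<forall>\<alpha>\<in>R. \<forall>\<beta>\<in>R. \<beta> \<in> weyl_orbit R \<alpha> \<longrightarrow> k \<alpha> = k \<beta>)"

definition orbit_hull :: "'a::euclidean_space set \<Rightarrow> 'a \<Rightarrow> 'a set" where
  "orbit_hull R x = closure (convex hull (weyl_orbit R x))"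


section \<open>Dunkl operators and the intertwiner\<close>

text \<open>
  A map into the complex numbers is a \<^const>\<open>polynomial_function\<close> iff its real and
  imaginary parts are real polynomial functions, that is, iff it is a polynomial function
  with complex coefficients.
\<close>

definition polys :: "('a::euclidean_space \<Rightarrow> complex) set" where
  "polys = {p. polynomial_function p}"

definition hom_polys :: "nat \<Rightarrow> ('a::euclidean_space \<Rightarrow> complex) set" where
  "hom_polys n = {p \<in> polys. \<forall>(t::real) x. p (t *\<^sub>R x) = of_real (t ^ n) * p x}"

definition dir_deriv :: "'a::euclidean_space \<Rightarrow> ('a \<Rightarrow> complex) \<Rightarrow> 'a \<Rightarrow> complex" where
  "dir_deriv \<xi> f x = frechet_derivative f (at x) \<xi>"

text \<open>
  For a polynomial \<open>f\<close>, the function \<open>(1 - \<sigma>\<^sub>\<alpha>) f\<close> is divisible by the linear form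
  \<open>\<langle>\<alpha>, \<cdot>\<rangle>\<close> and the quotient is a polynomial. It is defined as such, because pointwise
  division gives the junk value 0 on the hyperplane orthogonal to \<open>\<alpha>\<close>.
\<close>

definition dunkl_quotient :: "'a::euclidean_space \<Rightarrow> ('a \<Rightarrow> complex) \<Rightarrow> 'a \<Rightarrow> complex" where
  "dunkl_quotient \<alpha> f =
     (THE q. q \<in> polys \<and> (\<forall>x. of_real (\<alpha> \<bullet> x) * q x = f x - f (refl_in \<alpha> x)))"

definition dunkl_op ::
    "'a::euclidean_space set \<Rightarrow> ('a \<Rightarrow> real) \<Rightarrow> 'a \<Rightarrow> ('a \<Rightarrow> complex) \<Rightarrow> 'a \<Rightarrow> complex" where
  "dunkl_op P k \<xi> f x =
     dir_deriv \<xi> f x + (\<Sum>\<alpha>\<in>P. of_real (k \<alpha> * (\<alpha> \<bullet> \<xi>)) * dunkl_quotient \<alpha> f x)"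

text \<open>
  The conditions determine \<open>V\<close> on \<^const>\<open>polys\<close>; its values on other functions
  are irrelevant.
\<close>

definition dunkl_intertwiner ::
    "'a::euclidean_space set \<Rightarrow> ('a \<Rightarrow> real) \<Rightarrow> (('a \<Rightarrow> complex) \<Rightarrow> 'a \<Rightarrow> complex) \<Rightarrow> bool" where
  "dunkl_intertwiner P k V \<longleftrightarrow>
     (\<forall>p\<in>polys. \<forall>q\<in>polys. V (\<lambda>x. p x + q x) = (\<lambda>x. V p x + V q x)) \<and>
     (\<forall>p\<in>polys. \<forall>c. V (\<lambda>x. c * p x) = (\<lambda>x. c * V p x)) \<and>
     bij_betw V polys polys \<and>
     V (\<lambda>_. 1) = (\<lambda>_. 1) \<and>
     (\<forall>n. V ` hom_polys n = hom_polys n) \<and>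
     (\<forall>\<xi>. \<forall>p\<in>polys. dunkl_op P k \<xi> (V p) = V (dir_deriv \<xi> p))"


section \<open>Extension to the spaces \<open>A\<^sub>r\<close>\<close>

text \<open>
  A function on the ball \<open>K\<^sub>r\<close> is represented by a function on the whole space, of which
  only the values on \<^term>\<open>cball 0 r\<close> are used.
\<close>

definition hom_expansion ::
    "real \<Rightarrow> ('a::euclidean_space \<Rightarrow> complex) \<Rightarrow> (nat \<Rightarrow> 'a \<Rightarrow> complex) \<Rightarrow> bool" where
  "hom_expansion r f F \<longleftrightarrow>
     (\<forall>n. F n \<in> hom_polys n) \<and>
     summable (\<lambda>n. SUP y\<in>cball 0 r. norm (F n y)) \<and>
     (\<forall>y\<in>cball 0 r. (\<lambda>n. F n y) sums f y)"

definition A_space :: "real \<Rightarrow> ('a::euclidean_space \<Rightarrow> complex) set" where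
  "A_space r = {f. \<exists>F. hom_expansion r f F}"

text \<open>
  For \<open>r > 0\<close> the expansion is unique. For \<open>r = 0\<close> only the term of degree 0 is determined,
  but the value of the series at the single point of \<open>K\<^sub>0\<close> does not depend on the choice.
\<close>

definition V_ext ::
    "(('a::euclidean_space \<Rightarrow> complex) \<Rightarrow> 'a \<Rightarrow> complex) \<Rightarrow> real \<Rightarrow> ('a \<Rightarrow> complex) \<Rightarrow> 'a \<Rightarrow> complex" where
  "V_ext V r f y = (\<Sum>n. V ((SOME F. hom_expansion r f F) n) y)"


section \<open>Measures\<close>

definition borel_prob :: "'a::topological_space measure \<Rightarrow> bool" where
  "borel_prob \<mu> \<longleftrightarrow> sets \<mu> = sets borel \<and> prob_space \<mu>"

definition msupport :: "'a::topological_space measure \<Rightarrow> 'a set" where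
  "msupport \<mu> = {y. \<forall>U. open U \<longrightarrow> y \<in> U \<longrightarrow> emeasure \<mu> U > 0}"

definition representing_measure ::
    "(('a::euclidean_space \<Rightarrow> complex) \<Rightarrow> 'a \<Rightarrow> complex) \<Rightarrow> 'a \<Rightarrow> 'a measure \<Rightarrow> bool" where
  "representing_measure V x \<mu> \<longleftrightarrow>
     borel_prob \<mu> \<and>
     emeasure \<mu> (cball 0 (norm x)) = 1 \<and>
     (\<forall>f\<in>A_space (norm x).
        set_integrable \<mu> (cball 0 (norm x)) f \<and>
        V_ext V (norm x) f x = (LINT \<xi>:cball 0 (norm x)|\<mu>. f \<xi>))"

end

theory Submission
  imports Defs "HOL-Probability.Stream_Space" "HOL-Probability.Probability_Mass_Function"
begin

text \<open>
  The sum \<open>\<Sum>\<^sub>b \<langle>z, b\<rangle> T\<^sub>b\<close> over an orthonormal basis is the Euler operator plus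
  \<open>\<Sum>\<^sub>\<alpha> k\<^sub>\<alpha> (1 - \<sigma>\<^sub>\<alpha>)\<close>. Hence \<open>T\<^sub>\<xi> V = V \<partial>\<^sub>\<xi>\<close> gives, for \<open>p\<close> homogeneous of degree \<open>n\<close>,
  \<open>(n + \<gamma>) Vp(z) = \<Sum>\<^sub>\<alpha> k\<^sub>\<alpha> Vp(\<sigma>\<^sub>\<alpha> z) + V(\<partial>\<^sub>z p)(z)\<close> with \<open>\<gamma> = \<Sum>\<^sub>\<alpha> k\<^sub>\<alpha>\<close>,
  and since \<open>\<sigma>\<^sub>\<alpha>\<close> preserves spheres this recursion determines \<open>V\<close> by induction on the degree.
  Let \<open>Z\<^sub>t\<close> be the Markov jump process that starts in \<open>z\<close> and jumps from \<open>y\<close> to \<open>\<sigma>\<^sub>\<alpha> y\<close> with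
  rate \<open>k\<^sub>\<alpha>\<close>, and put \<open>\<xi>\<^sub>z = \<integral>\<^sub>0\<^sup>\<infinity> e\<^bsup>-t\<^esup> Z\<^sub>t dt\<close>. Conditioning on the first jump, at time \<open>t\<close>, shows that
  \<open>\<xi>\<^sub>z\<close> has the law of \<open>(1 - r) z + r \<xi>\<^bsub>\<sigma>\<^sub>\<alpha> z\<^esub>\<close> with \<open>r = e\<^bsup>-t\<^esup>\<close>, and an integration by parts in \<open>t\<close>
  turns this into the same recursion for \<open>E p(\<xi>\<^sub>z)\<close>. So \<open>Vp(z) = E p(\<xi>\<^sub>z)\<close>, and \<open>\<mu>\<^sub>x\<close> is the law
  of \<open>\<xi>\<^sub>x\<close>, an average of points of the orbit of \<open>x\<close>.
\<close>

section \<open>Polynomials and Dunkl operators\<close>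

lemma bounded_linear_refl_in: "bounded_linear (refl_in \<alpha>)"
proof -
  have "refl_in \<alpha> = (\<lambda>x. x - (x \<bullet> coroot \<alpha>) *\<^sub>R \<alpha>)"
    by (simp add: fun_eq_iff refl_in_def)
  thus ?thesis
    by (simp add: bounded_linear_sub bounded_linear_scaleR_const bounded_linear_inner_left_comp)
qed

text \<open>The zero vector multiplies the correction term, so no reflection takes place. It later
  serves as a jump that does not move the point.\<close>

lemma refl_in_0 [simp]: "refl_in 0 x = x"
  by (simp add: refl_in_def)

lemma norm_refl_in [simp]: "norm (refl_in \<alpha> x) = norm x"
proof (cases "\<alpha> = 0")
  case False
  have "(norm (refl_in \<alpha> x))\<^sup>2 = (norm x)\<^sup>2"
    using False by (simp add: power2_norm_eq_inner refl_in_def coroot_def inner_diff field_simps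
        inner_commute)
  thus ?thesis by simp
qed simp

section \<open>Homogeneous polynomials and their directional derivatives\<close>

lemma polysD: "p \<in> polys \<Longrightarrow> polynomial_function p"
  by (simp add: polys_def)

lemma hom_polysD:
  assumes "p \<in> hom_polys n"
  shows "polynomial_function p" "p (t *\<^sub>R x) = of_real (t ^ n) * p x"
  using assms by (auto simp: hom_polys_def polys_def)

lemma hom_polys_subset_polys: "hom_polys n \<subseteq> polys"
  by (auto simp: hom_polys_def)

lemma has_derivative_dir_deriv:
  assumes "polynomial_function p"
  shows "(p has_derivative (\<lambda>\<xi>. dir_deriv \<xi> p x)) (at x)"
proof -
  have "p differentiable (at x)"
    using assms by (rule differentiable_at_polynomial_function)
  thus ?thesis unfolding dir_deriv_def
    using frechet_derivative_works by metis
qed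

text \<open>Structural induction yields a derivative that is polynomial in the base point for each
  fixed direction, which the abstract \<open>frechet_derivative\<close> does not show by
  itself.\<close>

lemma real_polynomial_function_has_derivative:
  assumes "real_polynomial_function f"
  shows "\<exists>f'. (\<forall>x. (f has_derivative f' x) (at x)) \<and> (\<forall>\<xi>. real_polynomial_function (\<lambda>x. f' x \<xi>))"
  using assms
proof (induction rule: real_polynomial_function.induct)
  case (linear f)
  show ?case
    by (rule exI[of _ "\<lambda>_. f"])
      (auto intro: bounded_linear_imp_has_derivative linear)
next
  case (const c)
  show ?case
    by (rule exI[of _ "\<lambda>_ _. 0"]) auto
next
  case (add f g)
  then obtain f' g' where
    "\<And>x. (f has_derivative f' x) (at x)" "\<And>\<xi>. real_polynomial_function (\<lambda>x. f' x \<xi>)"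
    "\<And>x. (g has_derivative g' x) (at x)" "\<And>\<xi>. real_polynomial_function (\<lambda>x. g' x \<xi>)"
    by metis
  thus ?case
    by (intro exI[of _ "\<lambda>x \<xi>. f' x \<xi> + g' x \<xi>"])
      (auto intro!: has_derivative_add real_polynomial_function.intros(3))
next
  case (mult f g)
  then obtain f' g' where
    "\<And>x. (f has_derivative f' x) (at x)" "\<And>\<xi>. real_polynomial_function (\<lambda>x. f' x \<xi>)"
    "\<And>x. (g has_derivative g' x) (at x)" "\<And>\<xi>. real_polynomial_function (\<lambda>x. g' x \<xi>)"
    by metis
  thus ?case using mult.hyps
    by (intro exI[of _ "\<lambda>x \<xi>. f x * g' x \<xi> + f' x \<xi> * g x"])
      (auto intro!: has_derivative_mult real_polynomial_function.intros(3) real_polynomial_function.intros(4))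
qed

lemma polynomial_function_dir_deriv:
  assumes "polynomial_function p"
  shows "polynomial_function (dir_deriv \<xi> p)"
  unfolding polynomial_function_def
proof (intro allI impI)
  fix f :: "complex \<Rightarrow> real" assume f: "bounded_linear f"
  have "real_polynomial_function (f \<circ> p)"
    using assms f by (simp add: polynomial_function_def)
  then obtain f' where f': "\<And>x. ((f \<circ> p) has_derivative f' x) (at x)"
    "\<And>\<xi>. real_polynomial_function (\<lambda>x. f' x \<xi>)"
    using real_polynomial_function_has_derivative by metis
  have "((f \<circ> p) has_derivative (\<lambda>\<xi>. f (dir_deriv \<xi> p x))) (at x)" for x
    using bounded_linear.has_derivative[OF f has_derivative_dir_deriv[OF assms]]
    by (simp add: o_def)
  hence "f' x = (\<lambda>\<xi>. f (dir_deriv \<xi> p x))" for x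
    using f'(1) has_derivative_unique by blast
  thus "real_polynomial_function (f \<circ> dir_deriv \<xi> p)"
    using f'(2)[of \<xi>] by (simp add: o_def)
qed

lemma continuous_polynomial_function:
  "polynomial_function (p :: 'a::euclidean_space \<Rightarrow> complex) \<Longrightarrow> continuous_on S p"
  by (rule continuous_on_polymonial_function)

lemma dir_deriv_linear:
  assumes "polynomial_function p"
  shows "linear (\<lambda>\<xi>. dir_deriv \<xi> p x)"
  using has_derivative_dir_deriv[OF assms] has_derivative_linear by blast

lemma dir_deriv_sum_Basis:
  assumes "polynomial_function p"
  shows "(\<Sum>b\<in>Basis. of_real (z \<bullet> b) * dir_deriv b p x) = dir_deriv z p x"
proof -
  interpret linear "\<lambda>\<xi>. dir_deriv \<xi> p x" by (rule dir_deriv_linear[OF assms])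
  have "dir_deriv z p x = dir_deriv (\<Sum>b\<in>Basis. (z \<bullet> b) *\<^sub>R b) p x"
    by (simp add: euclidean_representation)
  also have "\<dots> = (\<Sum>b\<in>Basis. of_real (z \<bullet> b) * dir_deriv b p x)"
    by (simp add: sum scaleR scaleR_conv_of_real)
  finally show ?thesis by simp
qed

text \<open>Differentiation of p(ty) = t^n p(y) in y. The chain rule leaves the factor t on the
  left, so t = 0 is allowed and no exponent n - 1 occurs.\<close>

lemma dir_deriv_scaleR:
  assumes "p \<in> hom_polys n"
  shows "of_real t * dir_deriv \<xi> p (t *\<^sub>R x) = of_real (t ^ n) * dir_deriv \<xi> p x"
proof -
  note p = hom_polysD[OF assms]
  have "((\<lambda>y. p (t *\<^sub>R y)) has_derivative (\<lambda>\<xi>. dir_deriv (t *\<^sub>R \<xi>) p (t *\<^sub>R x))) (at x)"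
    by (rule has_derivative_compose[OF _ has_derivative_dir_deriv[OF p(1)]])
      (auto intro!: derivative_eq_intros)
  moreover have "((\<lambda>y. p (t *\<^sub>R y)) has_derivative (\<lambda>\<xi>. of_real (t ^ n) * dir_deriv \<xi> p x)) (at x)"
    unfolding p(2) by (intro has_derivative_mult_right has_derivative_dir_deriv p(1))
  ultimately have "dir_deriv (t *\<^sub>R \<xi>) p (t *\<^sub>R x) = of_real (t ^ n) * dir_deriv \<xi> p x"
    using has_derivative_unique by (metis (no_types, lifting))
  thus ?thesis
    by (simp add: linear_scale[OF dir_deriv_linear[OF p(1)]] scaleR_conv_of_real)
qed

text \<open>Euler's identity: both sides are the derivative of t -> p(tx) at t = 1.\<close>

lemma dir_deriv_euler:
  assumes "p \<in> hom_polys n"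
  shows "dir_deriv x p x = of_nat n * p x"
proof -
  note p = hom_polysD[OF assms]
  have "((\<lambda>t::real. p (t *\<^sub>R x)) has_derivative (\<lambda>t. dir_deriv (t *\<^sub>R x) p (1 *\<^sub>R x))) (at 1)"
    by (rule has_derivative_compose[OF _ has_derivative_dir_deriv[OF p(1)]])
      (auto intro!: derivative_eq_intros)
  moreover have "((\<lambda>t::real. p (t *\<^sub>R x)) has_derivative (\<lambda>t. of_real (of_nat n * t) * p x)) (at 1)"
    unfolding p(2) by (auto intro!: derivative_eq_intros simp: fun_eq_iff)
  ultimately have "(\<lambda>t::real. dir_deriv (t *\<^sub>R x) p (1 *\<^sub>R x)) = (\<lambda>t. of_real (of_nat n * t) * p x)"
    by (rule has_derivative_unique)
  from fun_cong[OF this, of 1] show ?thesis by simp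
qed

lemma dir_deriv_hom_polys:
  assumes "p \<in> hom_polys (Suc n)"
  shows "dir_deriv \<xi> p \<in> hom_polys n"
proof -
  note p = hom_polysD[OF assms]
  have poly: "polynomial_function (dir_deriv \<xi> p)"
    by (rule polynomial_function_dir_deriv[OF p(1)])
  have nz: "dir_deriv \<xi> p (t *\<^sub>R x) = of_real (t ^ n) * dir_deriv \<xi> p x" if "t \<noteq> 0" for t x
    using dir_deriv_scaleR[OF assms, of t \<xi> x] that by simp
  \<comment> \<open>The factor t cannot be cancelled at t = 0; there continuity in t
    decides.\<close>
  have "dir_deriv \<xi> p (0 *\<^sub>R x) = of_real (0 ^ n) * dir_deriv \<xi> p x" for x
  proof (rule LIM_unique)
    have "isCont (dir_deriv \<xi> p) y" for y
      using continuous_polynomial_function[OF poly, of UNIV] by (simp add: continuous_on_eq_continuous_at)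
    hence "isCont (\<lambda>t::real. dir_deriv \<xi> p (t *\<^sub>R x)) 0"
      by (intro isCont_o2[of "0::real" "\<lambda>t. t *\<^sub>R x" "dir_deriv \<xi> p"] continuous_intros)
    thus "((\<lambda>t::real. dir_deriv \<xi> p (t *\<^sub>R x)) \<longlongrightarrow> dir_deriv \<xi> p (0 *\<^sub>R x)) (at 0)"
      by (simp add: isCont_def)
    have "((\<lambda>t::real. of_real (t ^ n) * dir_deriv \<xi> p x) \<longlongrightarrow> of_real (0 ^ n) * dir_deriv \<xi> p x) (at 0)"
      by (intro tendsto_intros)
    thus "((\<lambda>t::real. dir_deriv \<xi> p (t *\<^sub>R x)) \<longlongrightarrow> of_real (0 ^ n) * dir_deriv \<xi> p x) (at 0)"
      by (rule Lim_transform_eventually) (auto simp: eventually_at nz intro!: exI[of _ 1])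
  qed
  with nz have "dir_deriv \<xi> p (t *\<^sub>R x) = of_real (t ^ n) * dir_deriv \<xi> p x" for t x
    by (cases "t = 0") auto
  with poly show ?thesis by (auto simp: hom_polys_def polys_def)
qed

section \<open>Divided differences along a reflection\<close>

lemma real_polynomial_function_refl_quotient:
  assumes "real_polynomial_function f" "\<alpha> \<noteq> 0"
  shows "\<exists>q. real_polynomial_function q \<and> (\<forall>x. (\<alpha> \<bullet> x) * q x = f x - f (refl_in \<alpha> x))"
  using assms(1)
proof (induction rule: real_polynomial_function.induct)
  case (linear f)
  interpret bounded_linear f by fact
  \<comment> \<open>A linear f changes under the reflection by
    \<open>(x \<bullet> coroot \<alpha>) * f \<alpha>\<close>, so the quotient is constant.\<close>
  show ?case
    by (rule exI[of _ "\<lambda>_. 2 / (\<alpha> \<bullet> \<alpha>) * f \<alpha>"])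
      (auto simp: refl_in_def coroot_def diff scaleR inner_commute)
next
  case (const c)
  show ?case
    by (rule exI[of _ "\<lambda>_. 0"]) auto
next
  case (add f g)
  then obtain p q where pq:
    "real_polynomial_function p" "\<And>x. (\<alpha> \<bullet> x) * p x = f x - f (refl_in \<alpha> x)"
    "real_polynomial_function q" "\<And>x. (\<alpha> \<bullet> x) * q x = g x - g (refl_in \<alpha> x)"
    by metis
  thus ?case
    by (intro exI[of _ "\<lambda>x. p x + q x"]) (auto simp: distrib_left intro: real_polynomial_function.intros(3))
next
  case (mult f g)
  then obtain p q where pq:
    "real_polynomial_function p" "\<And>x. (\<alpha> \<bullet> x) * p x = f x - f (refl_in \<alpha> x)"
    "real_polynomial_function q" "\<And>x. (\<alpha> \<bullet> x) * q x = g x - g (refl_in \<alpha> x)"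
    by metis
  \<comment> \<open>Twisted product rule: fg - (fg)\<sigma> = f (g - g\<sigma>) + (f - f\<sigma>)
    (g\<sigma>), where both differences are divisible by induction.\<close>
  have "real_polynomial_function (\<lambda>x. g (refl_in \<alpha> x))"
    using real_polynomial_function_compose[OF polynomial_function_bounded_linear[OF bounded_linear_refl_in] mult.hyps(2)]
    by (simp add: o_def)
  hence "real_polynomial_function (\<lambda>x. f x * q x + p x * g (refl_in \<alpha> x))"
    using pq mult.hyps by (intro real_polynomial_function.intros(3) real_polynomial_function.intros(4))
  moreover have "(\<alpha> \<bullet> x) * (f x * q x + p x * g (refl_in \<alpha> x)) =
      f x * g x - f (refl_in \<alpha> x) * g (refl_in \<alpha> x)" for x
  proof -
    have "(\<alpha> \<bullet> x) * (f x * q x + p x * g (refl_in \<alpha> x)) =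
        f x * ((\<alpha> \<bullet> x) * q x) + ((\<alpha> \<bullet> x) * p x) * g (refl_in \<alpha> x)"
      by (simp add: algebra_simps)
    thus ?thesis unfolding pq by (simp add: algebra_simps)
  qed
  ultimately show ?case by blast
qed

lemma polys_refl_quotient:
  assumes "p \<in> polys" "\<alpha> \<noteq> 0"
  shows "\<exists>q\<in>polys. \<forall>x. of_real (\<alpha> \<bullet> x) * q x = p x - p (refl_in \<alpha> x)"
proof -
  have "real_polynomial_function (Re \<circ> p)" "real_polynomial_function (Im \<circ> p)"
    using assms(1) by (auto simp: polys_def polynomial_function_def bounded_linear_Re bounded_linear_Im)
  then obtain a b where ab:
    "real_polynomial_function a" "\<And>x. (\<alpha> \<bullet> x) * a x = Re (p x) - Re (p (refl_in \<alpha> x))"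
    "real_polynomial_function b" "\<And>x. (\<alpha> \<bullet> x) * b x = Im (p x) - Im (p (refl_in \<alpha> x))"
    using real_polynomial_function_refl_quotient[OF _ assms(2)] by (metis comp_apply)
  have "(\<lambda>x. a x *\<^sub>R 1 + b x *\<^sub>R \<i>) \<in> polys"
    using ab(1,3) by (auto simp: polys_def real_polynomial_function_eq
        intro!: polynomial_function_add polynomial_function_mult)
  moreover have "of_real (\<alpha> \<bullet> x) * (a x *\<^sub>R 1 + b x *\<^sub>R \<i>) = p x - p (refl_in \<alpha> x)" for x
    by (rule complex_eqI) (simp_all add: ab)
  ultimately show ?thesis by (intro bexI[of _ "\<lambda>x. a x *\<^sub>R 1 + b x *\<^sub>R \<i>"] allI)
qed

text \<open>Off the hyperplane orthogonal to \<alpha> the factor cancels; a point x of the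
  hyperplane is the limit of x + t \<alpha> with t \<noteq> 0, so continuity decides. This makes the
  quotient in \<open>dunkl_quotient\<close> unique.\<close>

lemma inner_mult_cancel:
  fixes q q' :: "'a::euclidean_space \<Rightarrow> complex"
  assumes "continuous_on UNIV q" "continuous_on UNIV q'" "\<alpha> \<noteq> 0"
    and eq: "\<And>x. of_real (\<alpha> \<bullet> x) * q x = of_real (\<alpha> \<bullet> x) * q' x"
  shows "q = q'"
proof
  fix x
  show "q x = q' x"
  proof (cases "\<alpha> \<bullet> x = 0")
    case True
    have lim: "((\<lambda>t::real. h (x + t *\<^sub>R \<alpha>)) \<longlongrightarrow> h (x + 0 *\<^sub>R \<alpha>)) (at 0)"
      if "continuous_on UNIV h" for h :: "'a \<Rightarrow> complex"
    proof -
      have "isCont h y" for y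
        using that by (simp add: continuous_on_eq_continuous_at)
      hence "isCont (\<lambda>t::real. h (x + t *\<^sub>R \<alpha>)) 0"
        by (intro isCont_o2[of "0::real" "\<lambda>t. x + t *\<^sub>R \<alpha>" h] continuous_intros)
      thus ?thesis by (simp add: isCont_def)
    qed
    have "q (x + t *\<^sub>R \<alpha>) = q' (x + t *\<^sub>R \<alpha>)" if "t \<noteq> 0" for t
      using eq[of "x + t *\<^sub>R \<alpha>"] that True \<open>\<alpha> \<noteq> 0\<close> by (simp add: inner_add_right)
    hence "((\<lambda>t::real. q (x + t *\<^sub>R \<alpha>)) \<longlongrightarrow> q' (x + 0 *\<^sub>R \<alpha>)) (at 0)"
      by (intro Lim_transform_eventually[OF lim[OF assms(2)]])
        (auto simp: eventually_at intro!: exI[of _ 1])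
    from LIM_unique[OF lim[OF assms(1)] this] show ?thesis by simp
  qed (use eq[of x] in auto)
qed

lemma dunkl_quotient_mult:
  assumes "p \<in> polys" "\<alpha> \<noteq> 0"
  shows "of_real (\<alpha> \<bullet> x) * dunkl_quotient \<alpha> p x = p x - p (refl_in \<alpha> x)"
proof -
  have "\<exists>!q. q \<in> polys \<and> (\<forall>x. of_real (\<alpha> \<bullet> x) * q x = p x - p (refl_in \<alpha> x))"
  proof (rule ex_ex1I)
    show "\<exists>q. q \<in> polys \<and> (\<forall>x. of_real (\<alpha> \<bullet> x) * q x = p x - p (refl_in \<alpha> x))"
      using polys_refl_quotient[OF assms] by blast
  next
    fix q q' assume "q \<in> polys \<and> (\<forall>x. of_real (\<alpha> \<bullet> x) * q x = p x - p (refl_in \<alpha> x))"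
      "q' \<in> polys \<and> (\<forall>x. of_real (\<alpha> \<bullet> x) * q' x = p x - p (refl_in \<alpha> x))"
    thus "q = q'"
      using assms(2) by (intro inner_mult_cancel[of q q' \<alpha>])
        (auto intro: continuous_polynomial_function polysD)
  qed
  from theI'[OF this] show ?thesis
    unfolding dunkl_quotient_def by blast
qed

text \<open>Under the sum over the basis the factors \<open>\<alpha> \<bullet> b\<close> add up to
  \<open>\<alpha> \<bullet> z\<close>, the denominator of the Dunkl quotient, so no division is
  left; the derivatives add up to Euler's operator.\<close>

lemma dunkl_op_euler:
  assumes "p \<in> hom_polys n" "finite P" "0 \<notin> P"
  shows "(\<Sum>b\<in>Basis. of_real (z \<bullet> b) * dunkl_op P k b p z) =
    of_nat n * p z + (\<Sum>\<alpha>\<in>P. of_real (k \<alpha>) * (p z - p (refl_in \<alpha> z)))"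
proof -
  have poly: "p \<in> polys"
    using assms(1) hom_polys_subset_polys by blast
  have "(\<Sum>b\<in>Basis. of_real (z \<bullet> b) * dunkl_op P k b p z) =
      (\<Sum>b\<in>Basis. of_real (z \<bullet> b) * dir_deriv b p z) +
      (\<Sum>\<alpha>\<in>P. \<Sum>b\<in>Basis. of_real (z \<bullet> b) * (of_real (k \<alpha> * (\<alpha> \<bullet> b)) * dunkl_quotient \<alpha> p z))"
    by (subst sum.swap)
      (simp add: dunkl_op_def distrib_left sum.distrib sum_distrib_left)
  also have "(\<Sum>b\<in>Basis. of_real (z \<bullet> b) * dir_deriv b p z) = of_nat n * p z"
    by (simp only: dir_deriv_sum_Basis[OF polysD[OF poly]] dir_deriv_euler[OF assms(1)])
  also have "(\<Sum>\<alpha>\<in>P. \<Sum>b\<in>Basis. of_real (z \<bullet> b) * (of_real (k \<alpha> * (\<alpha> \<bullet> b)) * dunkl_quotient \<alpha> p z)) =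
      (\<Sum>\<alpha>\<in>P. of_real (k \<alpha>) * (p z - p (refl_in \<alpha> z)))"
  proof (rule sum.cong[OF HOL.refl])
    fix \<alpha> assume "\<alpha> \<in> P"
    hence "\<alpha> \<noteq> 0" using assms(3) by auto
    have "(\<Sum>b\<in>Basis. of_real (z \<bullet> b) * (of_real (k \<alpha> * (\<alpha> \<bullet> b)) * dunkl_quotient \<alpha> p z)) =
        of_real (k \<alpha>) * (of_real (\<Sum>b\<in>Basis. (\<alpha> \<bullet> b) * (z \<bullet> b)) * dunkl_quotient \<alpha> p z)"
      by (simp add: sum_distrib_left sum_distrib_right mult_ac)
    also have "(\<Sum>b\<in>Basis. (\<alpha> \<bullet> b) * (z \<bullet> b)) = \<alpha> \<bullet> z"
      by (rule euclidean_inner[symmetric])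
    also have "of_real (\<alpha> \<bullet> z) * dunkl_quotient \<alpha> p z = p z - p (refl_in \<alpha> z)"
      by (rule dunkl_quotient_mult[OF poly \<open>\<alpha> \<noteq> 0\<close>])
    finally show "(\<Sum>b\<in>Basis. of_real (z \<bullet> b) * (of_real (k \<alpha> * (\<alpha> \<bullet> b)) * dunkl_quotient \<alpha> p z)) =
        of_real (k \<alpha>) * (p z - p (refl_in \<alpha> z))" .
  qed
  finally show ?thesis .
qed

text \<open>\<open>V p\<close> is again homogeneous of degree \<open>Suc n\<close>, so the preceding
  identity applies to it, and the intertwining relation rewrites its left side.\<close>

lemma dunkl_intertwiner_recursion:
  assumes V: "dunkl_intertwiner P k V" and "finite P" "0 \<notin> P" "p \<in> hom_polys (Suc n)"
  shows "of_nat (Suc n) * V p z + (\<Sum>\<alpha>\<in>P. of_real (k \<alpha>) * (V p z - V p (refl_in \<alpha> z))) =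
    (\<Sum>b\<in>Basis. of_real (z \<bullet> b) * V (dir_deriv b p) z)"
proof -
  have "V p \<in> hom_polys (Suc n)"
    using V assms(4) unfolding dunkl_intertwiner_def by blast
  note euler = dunkl_op_euler[OF this assms(2,3), of z k]
  have "p \<in> polys"
    using assms(4) hom_polys_subset_polys by blast
  hence "dunkl_op P k b (V p) z = V (dir_deriv b p) z" for b
    using V unfolding dunkl_intertwiner_def by metis
  with euler show ?thesis by simp
qed

section \<open>Discounted averages of a random walk generated by reflections\<close>

text \<open>The tool for conditioning on the first jump: the first letter of an i.i.d. stream is
  independent of the tail, which has the law of the whole stream.\<close>

lemma (in prob_space) stream_space_distr_Stream:
  "distr (M \<Otimes>\<^sub>M stream_space M) (stream_space M) (\<lambda>(a, \<omega>). a ## \<omega>) = stream_space M"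
proof (rule measure_eqI)
  interpret S: prob_space "stream_space M" by (rule prob_space_stream_space)
  interpret pair_sigma_finite M "stream_space M" ..
  have meas[measurable]: "(\<lambda>(a, \<omega>). a ## \<omega>) \<in> measurable (M \<Otimes>\<^sub>M stream_space M) (stream_space M)"
    by simp
  fix X assume "X \<in> sets (distr (M \<Otimes>\<^sub>M stream_space M) (stream_space M) (\<lambda>(a, \<omega>). a ## \<omega>))"
  hence X[measurable]: "X \<in> sets (stream_space M)" by simp
  have "emeasure (distr (M \<Otimes>\<^sub>M stream_space M) (stream_space M) (\<lambda>(a, \<omega>). a ## \<omega>)) X =
      (\<integral>\<^sup>+ z. indicator X z \<partial>distr (M \<Otimes>\<^sub>M stream_space M) (stream_space M) (\<lambda>(a, \<omega>). a ## \<omega>))"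
    by simp
  also have "\<dots> = (\<integral>\<^sup>+ a. (\<integral>\<^sup>+ \<omega>. indicator X (a ## \<omega>) \<partial>stream_space M) \<partial>M)"
    by (subst nn_integral_distr) (simp_all add: S.nn_integral_fst[symmetric] case_prod_beta)
  also have "\<dots> = (\<integral>\<^sup>+ z. indicator X z \<partial>stream_space M)"
    by (rule nn_integral_stream_space[symmetric]) simp
  finally show "emeasure (distr (M \<Otimes>\<^sub>M stream_space M) (stream_space M) (\<lambda>(a, \<omega>). a ## \<omega>)) X =
      emeasure (stream_space M) X" by simp
qed simp

lemma bounded_on_cball:
  fixes f :: "'a::euclidean_space \<Rightarrow> 'b::real_normed_vector"
  assumes "continuous_on UNIV f"
  shows "\<exists>C. \<forall>y. norm y \<le> r \<longrightarrow> norm (f y) \<le> C"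
proof -
  have "compact (f ` cball 0 r)"
    by (intro compact_continuous_image continuous_on_subset[OF assms]) auto
  thus ?thesis
    by (meson bounded_iff compact_imp_bounded imageI mem_cball_0)
qed

text \<open>\<open>\<kappa>\<close> holds the jump rates. Positivity of their sum allows them to be
  normalised to the law of the next reflection.\<close>

locale reflection_average =
  fixes A :: "'a::euclidean_space set" and \<kappa> :: "'a \<Rightarrow> real"
  assumes fin: "finite A" and nonneg: "\<alpha> \<in> A \<Longrightarrow> 0 \<le> \<kappa> \<alpha>" and pos: "0 < sum \<kappa> A"
begin

definition total :: real where "total = sum \<kappa> A"

definition root_pmf :: "'a pmf" where
  "root_pmf = embed_pmf (\<lambda>\<alpha>. if \<alpha> \<in> A then \<kappa> \<alpha> / total else 0)"

definition unif :: "real measure" where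
  "unif = density lborel (indicator {0..1})"

text \<open>One letter carries the reflection to be applied and the uniform variable that encodes
  the waiting time before it.\<close>

definition steps :: "('a \<times> real) measure" where
  "steps = measure_pmf root_pmf \<Otimes>\<^sub>M unif"

text \<open>If \<open>u\<close> is uniform on the unit interval, this has density \<open>\<gamma> r\<^bsup>\<gamma>-1\<^esup>\<close> with
  \<open>\<gamma> = total\<close>, that is, it is \<open>e\<^bsup>-t\<^esup>\<close> for an exponential waiting time \<open>t\<close> of rate \<open>\<gamma>\<close>.\<close>
definition ratio :: "real \<Rightarrow> real" where
  "ratio u = min 1 \<bar>u\<bar> powr (1 / total)"

primrec walk :: "nat \<Rightarrow> 'a \<Rightarrow> ('a \<times> real) stream \<Rightarrow> 'a" where
  "walk 0 z \<omega> = z"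
| "walk (Suc n) z \<omega> = refl_in (fst (\<omega> !! n)) (walk n z \<omega>)"

text \<open>With \<tau> the time of the n-th jump this is e^(-\<tau>), the product of the factors
  for the separate waiting times.\<close>

definition discount :: "nat \<Rightarrow> ('a \<times> real) stream \<Rightarrow> real" where
  "discount n \<omega> = (\<Prod>j<n. ratio (snd (\<omega> !! j)))"

text \<open>The integral of e^(-t) Z(t), split at the jump times: Z is constant between two jumps,
  and e^(-t) has integral \<open>discount n \<omega> - discount (Suc n) \<omega>\<close> over that
  interval.\<close>

definition average :: "'a \<Rightarrow> ('a \<times> real) stream \<Rightarrow> 'a" where
  "average z \<omega> = (\<Sum>n. (discount n \<omega> - discount (Suc n) \<omega>) *\<^sub>R walk n z \<omega>)"

section \<open>Measurability, bounds and convergence\<close>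

lemma total_pos: "0 < total"
  using pos by (simp add: total_def)

lemma pmf_root_pmf: "pmf root_pmf \<alpha> = (if \<alpha> \<in> A then \<kappa> \<alpha> / total else 0)"
  unfolding root_pmf_def
proof (rule pmf_embed_pmf)
  show "0 \<le> (if \<alpha> \<in> A then \<kappa> \<alpha> / total else 0)" for \<alpha>
    using nonneg total_pos by (simp add: less_imp_le)
  have "(\<integral>\<^sup>+ \<alpha>. ennreal (if \<alpha> \<in> A then \<kappa> \<alpha> / total else 0) \<partial>count_space UNIV) =
      (\<Sum>\<alpha>\<in>A. ennreal (\<kappa> \<alpha> / total))"
    using fin by (subst nn_integral_count_space'[of A]) auto
  also have "\<dots> = ennreal (\<Sum>\<alpha>\<in>A. \<kappa> \<alpha> / total)"
    using nonneg total_pos by (intro sum_ennreal) (simp add: less_imp_le)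
  also have "(\<Sum>\<alpha>\<in>A. \<kappa> \<alpha> / total) = 1"
    using total_pos by (simp add: sum_divide_distrib[symmetric] total_def)
  finally show "(\<integral>\<^sup>+ \<alpha>. ennreal (if \<alpha> \<in> A then \<kappa> \<alpha> / total else 0) \<partial>count_space UNIV) = 1"
    by simp
qed

lemma integral_root_pmf:
  fixes f :: "'a \<Rightarrow> 'b::{banach, second_countable_topology}"
  shows "(LINT \<alpha>|measure_pmf root_pmf. f \<alpha>) = (\<Sum>\<alpha>\<in>A. (\<kappa> \<alpha> / total) *\<^sub>R f \<alpha>)"
proof -
  have "(LINT \<alpha>|measure_pmf root_pmf. f \<alpha>) = (\<Sum>\<alpha>\<in>A. pmf root_pmf \<alpha> *\<^sub>R f \<alpha>)"
    by (rule integral_measure_pmf[OF fin]) (auto simp: set_pmf_eq pmf_root_pmf split: if_splits)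
  thus ?thesis by (simp add: pmf_root_pmf)
qed

lemma sets_unif [measurable_cong]: "sets unif = sets borel"
  by (simp add: unif_def)

lemma prob_space_unif: "prob_space unif"
  by (rule prob_spaceI) (simp add: unif_def emeasure_density)

lemma sets_steps [measurable_cong]: "sets steps = sets (count_space UNIV \<Otimes>\<^sub>M borel)"
  unfolding steps_def by (intro sets_pair_measure_cong) (simp_all add: sets_unif)

lemma space_steps: "space steps = UNIV"
  by (simp add: steps_def unif_def space_pair_measure)

lemma prob_space_steps: "prob_space steps"
proof -
  interpret U: prob_space unif by (rule prob_space_unif)
  interpret pair_prob_space "measure_pmf root_pmf" unif ..
  show ?thesis unfolding steps_def by unfold_locales
qed

lemma measurable_ratio [measurable]: "ratio \<in> borel_measurable borel"
  unfolding ratio_def by measurable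

text \<open>The cut-off \<open>min 1 \<bar>u\<bar>\<close> in \<open>ratio\<close> gives these
  bounds for every real u, so that the estimates below hold on every path and not only almost
  surely.\<close>

lemma ratio_bounds: "0 \<le> ratio u" "ratio u \<le> 1"
  using total_pos powr_mono2[of "1 / total" "min 1 \<bar>u\<bar>" 1] by (auto simp: ratio_def)

lemma measurable_root [measurable]: "(\<lambda>\<omega>. fst (\<omega> !! n)) \<in> borel_measurable (stream_space steps)"
proof -
  have "fst \<in> borel_measurable steps"
    unfolding steps_def by (rule measurable_compose[OF measurable_fst]) simp
  thus ?thesis by measurable
qed

lemma measurable_refl_in [measurable (raw)]:
  assumes [measurable]: "f \<in> borel_measurable M" "g \<in> borel_measurable M"
  shows "(\<lambda>\<omega>. refl_in (f \<omega>) (g \<omega>)) \<in> borel_measurable M"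
  unfolding refl_in_def coroot_def by measurable

lemma measurable_walk [measurable]: "walk n z \<in> borel_measurable (stream_space steps)"
  by (induction n) (simp_all del: walk.simps(1) add: walk.simps(1)[abs_def])

lemma measurable_discount [measurable]: "discount n \<in> borel_measurable (stream_space steps)"
proof -
  have "(\<lambda>\<omega>. snd (\<omega> !! n)) \<in> borel_measurable (stream_space steps)" for n
    by measurable
  thus ?thesis unfolding discount_def[abs_def] by measurable
qed

lemma measurable_average [measurable]: "average z \<in> borel_measurable (stream_space steps)"
  unfolding average_def[abs_def] by measurable

lemma norm_walk: "norm (walk n z \<omega>) = norm z"
  by (induction n) simp_all

lemma discount_0 [simp]: "discount 0 \<omega> = 1"
  by (simp add: discount_def)

lemma discount_nonneg: "0 \<le> discount n \<omega>"
  unfolding discount_def by (intro prod_nonneg) (simp add: ratio_bounds)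

lemma discount_decreasing: "discount (Suc n) \<omega> \<le> discount n \<omega>"
  using mult_left_mono[OF ratio_bounds(2) discount_nonneg, of n \<omega>]
  by (simp add: discount_def)

text \<open>The weights telescope. The limit l of the discounts can be positive, for instance if
  every ratio is 1; a total weight of at most 1 suffices for the norm bounds.\<close>

lemma weights_sums: "\<exists>l\<ge>0. (\<lambda>n. discount n \<omega> - discount (Suc n) \<omega>) sums (1 - l)"
proof -
  have "decseq (\<lambda>n. discount n \<omega>)"
    by (rule decseq_SucI) (rule discount_decreasing)
  then obtain l where l: "(\<lambda>n. discount n \<omega>) \<longlonglongrightarrow> l"
    by (rule decseq_convergent[of _ 0]) (auto intro: discount_nonneg)
  moreover have "0 \<le> l"
    by (rule LIMSEQ_le_const[OF l]) (auto simp: discount_nonneg)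
  ultimately show ?thesis using telescope_sums'[OF l] by auto
qed

lemma average_summable:
  "summable (\<lambda>n. norm ((discount n \<omega> - discount (Suc n) \<omega>) *\<^sub>R walk n z \<omega>))"
proof -
  have "norm ((discount n \<omega> - discount (Suc n) \<omega>) *\<^sub>R walk n z \<omega>) =
      (discount n \<omega> - discount (Suc n) \<omega>) * norm z" for n
    using discount_decreasing[of n \<omega>] by (simp add: norm_walk)
  thus ?thesis
    using weights_sums[of \<omega>] by (auto simp: sums_iff intro: summable_mult2)
qed

lemma norm_average: "norm (average z \<omega>) \<le> norm z"
proof -
  obtain l where l: "0 \<le> l" "(\<lambda>n. discount n \<omega> - discount (Suc n) \<omega>) sums (1 - l)"
    using weights_sums by blast
  have eq: "norm ((discount n \<omega> - discount (Suc n) \<omega>) *\<^sub>R walk n z \<omega>) =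
      (discount n \<omega> - discount (Suc n) \<omega>) * norm z" for n
    using discount_decreasing[of n \<omega>] by (simp add: norm_walk)
  have "norm (average z \<omega>) \<le> (\<Sum>n. norm ((discount n \<omega> - discount (Suc n) \<omega>) *\<^sub>R walk n z \<omega>))"
    unfolding average_def by (rule summable_norm[OF average_summable])
  also have "\<dots> = (1 - l) * norm z"
    unfolding eq using sums_mult2[OF l(2), of "norm z"] by (simp add: sums_iff)
  also have "\<dots> \<le> norm z"
    using l(1) by (simp add: mult_left_le_one_le algebra_simps)
  finally show ?thesis .
qed

lemma walk_Stream: "walk (Suc n) z (a ## \<omega>) = walk n (refl_in (fst a) z) \<omega>"
  by (induction n) simp_all

lemma discount_Stream: "discount (Suc n) (a ## \<omega>) = ratio (snd a) * discount n \<omega>"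
  unfolding discount_def by (subst prod.lessThan_Suc_shift) simp

text \<open>Pathwise form of the conditioning on the first jump: the first holding interval gives z
  the weight \<open>1 - ratio (snd a)\<close>, and all later weights share the factor
  \<open>ratio (snd a)\<close>, with the walk restarted at the reflected point.\<close>

lemma average_Stream:
  "average z (a ## \<omega>) =
    (1 - ratio (snd a)) *\<^sub>R z + ratio (snd a) *\<^sub>R average (refl_in (fst a) z) \<omega>"
proof -
  let ?f = "\<lambda>n. (discount n (a ## \<omega>) - discount (Suc n) (a ## \<omega>)) *\<^sub>R walk n z (a ## \<omega>)"
  let ?g = "\<lambda>n. (discount n \<omega> - discount (Suc n) \<omega>) *\<^sub>R walk n (refl_in (fst a) z) \<omega>"
  have "average z (a ## \<omega>) = ?f 0 + (\<Sum>n. ?f (Suc n))"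
    unfolding average_def
    using suminf_split_head[OF summable_norm_cancel[OF average_summable[of "a ## \<omega>" z]]] by simp
  also have "?f 0 = (1 - ratio (snd a)) *\<^sub>R z"
    using discount_Stream[of 0 a \<omega>] by simp
  also have "(\<lambda>n. ?f (Suc n)) = (\<lambda>n. ratio (snd a) *\<^sub>R ?g n)"
    unfolding discount_Stream walk_Stream by (simp add: right_diff_distrib)
  also have "(\<Sum>n. ratio (snd a) *\<^sub>R ?g n) = ratio (snd a) *\<^sub>R average (refl_in (fst a) z) \<omega>"
    unfolding average_def by (rule suminf_scaleR_right[OF summable_norm_cancel[OF average_summable], symmetric])
  finally show ?thesis .
qed

text \<open>Passage from the Lebesgue to the gauge integral, where the fundamental theorem of
  calculus is available.\<close>

lemma integral_unif:
  fixes f :: "real \<Rightarrow> 'b::euclidean_space"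
  assumes "continuous_on {0..1} f" "f \<in> borel_measurable borel"
  shows "(LINT u|unif. f u) = integral {0..1} f"
proof -
  have dens: "unif = density lborel (\<lambda>u. ennreal (indicator {0..1} u))"
    by (simp add: unif_def ennreal_indicator)
  have "(LINT u|unif. f u) = (LINT u:{0..1}|lborel. f u)"
    unfolding dens set_lebesgue_integral_def using assms(2)
    by (intro integral_density) auto
  also have "\<dots> = integral {0..1} f"
    by (intro set_borel_integral_eq_integral borel_integrable_compact)
      (auto simp: set_integrable_def intro!: borel_integrable_compact assms(1))
  finally show ?thesis .
qed

text \<open>Expectation of \<open>average_Stream\<close>. The integral over u is moved inside so
  that it can be evaluated with the endpoint \<open>average (refl_in \<alpha> z) \<omega>\<close>
  held fixed.\<close>

lemma integral_average:
  fixes f :: "'a \<Rightarrow> 'b::{banach, second_countable_topology}"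
  assumes f: "continuous_on UNIV f"
  shows "(LINT \<omega>|stream_space steps. f (average z \<omega>)) =
    (\<Sum>\<alpha>\<in>A. (\<kappa> \<alpha> / total) *\<^sub>R (LINT \<omega>|stream_space steps.
      (LINT u|unif. f ((1 - ratio u) *\<^sub>R z + ratio u *\<^sub>R average (refl_in \<alpha> z) \<omega>))))"
proof -
  interpret U: prob_space unif by (rule prob_space_unif)
  interpret B: prob_space steps by (rule prob_space_steps)
  interpret S: prob_space "stream_space steps" by (rule B.prob_space_stream_space)
  interpret RU: pair_prob_space "measure_pmf root_pmf" unif ..
  interpret BS: pair_prob_space steps "stream_space steps" ..
  interpret US: pair_prob_space unif "stream_space steps" ..
  have [measurable]: "f \<in> borel_measurable borel"
    by (rule borel_measurable_continuous_onI[OF f])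
  obtain C where C: "\<And>y. norm y \<le> norm z \<Longrightarrow> norm (f y) \<le> C"
    using bounded_on_cball[OF f] by blast
  \<comment> \<open>The argument of f is the average along the stream with first letter
    \<open>(\<alpha>, u)\<close>, hence lies in the ball of radius \<open>norm z\<close>.\<close>
  have bound: "norm (f ((1 - ratio u) *\<^sub>R z + ratio u *\<^sub>R average (refl_in \<alpha> z) \<omega>)) \<le> C" for u \<alpha> \<omega>
  proof (rule C)
    show "norm ((1 - ratio u) *\<^sub>R z + ratio u *\<^sub>R average (refl_in \<alpha> z) \<omega>) \<le> norm z"
      using norm_average[of z "(\<alpha>, u) ## \<omega>"] unfolding average_Stream by simp
  qed
  let ?h = "\<lambda>\<alpha> u \<omega>. f ((1 - ratio u) *\<^sub>R z + ratio u *\<^sub>R average (refl_in \<alpha> z) \<omega>)"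
  have av[measurable]: "(\<lambda>(a, \<omega>). average z (a ## \<omega>)) \<in> borel_measurable (steps \<Otimes>\<^sub>M stream_space steps)"
    by measurable
  define G where "G a = (LINT \<omega>|stream_space steps. f (average z (a ## \<omega>)))" for a
  have "(LINT \<omega>|stream_space steps. f (average z \<omega>)) =
      (LINT (a, \<omega>)|(steps \<Otimes>\<^sub>M stream_space steps). f (average z (a ## \<omega>)))"
    by (subst B.stream_space_distr_Stream[symmetric], subst integral_distr)
      (auto simp: split_beta')
  also have "\<dots> = (LINT a|steps. G a)"
  proof (subst BS.integral_fst'[symmetric])
    show "integrable (steps \<Otimes>\<^sub>M stream_space steps) (\<lambda>(a, \<omega>). f (average z (a ## \<omega>)))"
      by (rule BS.integrable_const_bound[of _ C]) (auto simp: split_beta' intro!: C norm_average)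
  qed (simp add: G_def[abs_def])
  also have "\<dots> = (LINT \<alpha>|measure_pmf root_pmf. LINT u|unif. G (\<alpha>, u))"
    unfolding steps_def
  proof (rule RU.integral_fst'[symmetric], rule RU.integrable_const_bound[of _ C])
    have [measurable]: "(\<lambda>\<omega>. average z (a ## \<omega>)) \<in> borel_measurable (stream_space steps)" for a
      by (rule measurable_compose[OF _ measurable_average]) (simp add: space_steps)
    have "norm (G a) \<le> C" for a
      unfolding G_def using C norm_average
      by (intro S.integral_le_const[THEN order_trans[OF integral_norm_bound]])
        (auto intro!: S.integrable_const_bound[of _ C])
    thus "AE a in measure_pmf root_pmf \<Otimes>\<^sub>M unif. norm (G a) \<le> C" by simp
    show "G \<in> borel_measurable (measure_pmf root_pmf \<Otimes>\<^sub>M unif)"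
      unfolding steps_def[symmetric] G_def by measurable
  qed
  also have "\<dots> = (LINT \<alpha>|measure_pmf root_pmf. LINT u|unif. LINT \<omega>|stream_space steps. ?h \<alpha> u \<omega>)"
    by (simp add: G_def average_Stream)
  also have "\<dots> = (\<Sum>\<alpha>\<in>A. (\<kappa> \<alpha> / total) *\<^sub>R (LINT u|unif. LINT \<omega>|stream_space steps. ?h \<alpha> u \<omega>))"
    by (rule integral_root_pmf)
  finally have *: "(LINT \<omega>|stream_space steps. f (average z \<omega>)) =
      (\<Sum>\<alpha>\<in>A. (\<kappa> \<alpha> / total) *\<^sub>R (LINT u|unif. LINT \<omega>|stream_space steps. ?h \<alpha> u \<omega>))" .
  have "(LINT u|unif. LINT \<omega>|stream_space steps. ?h \<alpha> u \<omega>) =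
      (LINT \<omega>|stream_space steps. LINT u|unif. ?h \<alpha> u \<omega>)" for \<alpha>
    using bound by (intro US.Fubini_integral[symmetric] US.integrable_const_bound[of _ C])
     (auto simp: split_beta')
  thus ?thesis by (simp only: *)
qed


section \<open>The mean of the ratio and concentration in convex sets\<close>

lemma ratio_eq: "u \<in> {0..1} \<Longrightarrow> ratio u = u powr (1 / total)"
  by (simp add: ratio_def)

lemma continuous_on_ratio: "continuous_on {0..1} ratio"
proof -
  have "continuous_on {0..1::real} (\<lambda>u. u powr (1 / total))"
    using total_pos by (intro continuous_on_powr') (auto intro!: continuous_intros)
  thus ?thesis by (rule continuous_on_eq) (simp add: ratio_eq)
qed

text \<open>The mean is \<open>total / (total + 1)\<close>, from the integral of a power. It will be
  the contraction factor for the distance to a convex set.\<close>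

lemma expectation_ratio: "(LINT u|unif. ratio u) < 1"
proof -
  have "((\<lambda>u::real. u powr (1 / total)) has_integral (1 powr (1 / total + 1) / (1 / total + 1))) {0..1}"
    using total_pos by (intro has_integral_powr_from_0) (auto intro: less_le_trans[of _ 0])
  hence "(ratio has_integral (1 / (1 / total + 1))) {0..1}"
    unfolding powr_one_eq_one by (rule has_integral_eq[rotated]) (simp add: ratio_eq)
  hence "(LINT u|unif. ratio u) = 1 / (1 / total + 1)"
    by (simp add: integral_unif[OF continuous_on_ratio] integral_unique)
  also have "\<dots> < 1"
    using total_pos by (simp add: field_simps)
  finally show ?thesis .
qed

lemma prob_space_stream_steps: "prob_space (stream_space steps)"
  by (rule prob_space.prob_space_stream_space[OF prob_space_steps])

lemma integrable_average:
  fixes f :: "'a \<Rightarrow> 'b::{banach, second_countable_topology}"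
  assumes f: "continuous_on UNIV f"
  shows "integrable (stream_space steps) (\<lambda>\<omega>. f (average z \<omega>))"
proof -
  interpret S: prob_space "stream_space steps" by (rule prob_space_stream_steps)
  have [measurable]: "f \<in> borel_measurable borel"
    by (rule borel_measurable_continuous_onI[OF f])
  obtain C where "\<And>y. norm y \<le> norm z \<Longrightarrow> norm (f y) \<le> C"
    using bounded_on_cball[OF f] by blast
  thus ?thesis
    using norm_average by (intro S.integrable_const_bound[of _ C]) auto
qed

lemma integrable_unif:
  fixes f :: "'a \<Rightarrow> 'b::{banach, second_countable_topology}"
  assumes f: "continuous_on UNIV f"
  shows "integrable unif (\<lambda>u. f ((1 - ratio u) *\<^sub>R z + ratio u *\<^sub>R w))"
proof -
  interpret U: prob_space unif by (rule prob_space_unif)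
  have [measurable]: "f \<in> borel_measurable borel"
    by (rule borel_measurable_continuous_onI[OF f])
  obtain C where C: "\<And>y. norm y \<le> norm z + norm w \<Longrightarrow> norm (f y) \<le> C"
    using bounded_on_cball[OF f] by blast
  have "norm ((1 - ratio u) *\<^sub>R z + ratio u *\<^sub>R w) \<le> norm z + norm w" for u
    using ratio_bounds[of u]
    by (intro order_trans[OF norm_triangle_ineq] add_mono) (auto simp: mult_left_le_one_le)
  thus ?thesis
    using C by (intro U.integrable_const_bound[of _ C]) auto
qed

text \<open>Since \<open>ratio\<close> has mean below 1, one step of the walk contracts the supremum over \<open>S\<close> of the
  expected distance of the average from \<open>C\<close>.\<close>
lemma AE_average_in_convex:
  assumes C: "closed C" "convex C" and S: "bounded S" "S \<subseteq> C"
    and invariant: "\<And>z \<alpha>. z \<in> S \<Longrightarrow> \<alpha> \<in> A \<Longrightarrow> refl_in \<alpha> z \<in> S" and "z \<in> S"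
  shows "AE \<omega> in stream_space steps. average z \<omega> \<in> C"
proof -
  interpret S: prob_space "stream_space steps" by (rule prob_space_stream_steps)
  interpret U: prob_space unif by (rule prob_space_unif)
  define D where "D y = infdist y C" for y
  define h where "h z = (LINT \<omega>|stream_space steps. D (average z \<omega>))" for z
  define \<rho> where "\<rho> = (LINT u|unif. ratio u)"
  have "C \<noteq> {}" using S(2) \<open>z \<in> S\<close> by blast
  have D_cont: "continuous_on UNIV D"
    unfolding D_def by (intro continuous_intros)
  have D_nonneg: "0 \<le> D y" for y
    by (simp add: D_def infdist_nonneg)
  have h_nonneg: "0 \<le> h z" for z
    unfolding h_def by (intro integral_nonneg_AE AE_I2 D_nonneg)
  \<comment> \<open>Replacing w by a nearest point c of C moves the combination by
    \<open>ratio u * D w\<close> and, by convexity, into C.\<close>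
  have D_average: "D ((1 - ratio u) *\<^sub>R z + ratio u *\<^sub>R w) \<le> ratio u * D w" if "z \<in> S" for u z w
  proof -
    obtain c where c: "c \<in> C" "infdist w C = dist w c"
      using infdist_attains_inf[OF C(1) \<open>C \<noteq> {}\<close>] by blast
    have "(1 - ratio u) *\<^sub>R z + ratio u *\<^sub>R c \<in> C"
      using that S(2) ratio_bounds[of u] by (intro convexD[OF C(2)] c(1)) auto
    hence "D ((1 - ratio u) *\<^sub>R z + ratio u *\<^sub>R w) \<le>
        dist ((1 - ratio u) *\<^sub>R z + ratio u *\<^sub>R w) ((1 - ratio u) *\<^sub>R z + ratio u *\<^sub>R c)"
      unfolding D_def by (rule infdist_le)
    also have "\<dots> = norm (ratio u *\<^sub>R (w - c))"
      by (simp add: dist_norm algebra_simps)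
    also have "\<dots> = ratio u * D w"
      using ratio_bounds[of u] by (simp add: c(2) D_def dist_norm)
    finally show ?thesis .
  qed
  have int_ratio: "integrable unif ratio"
    using ratio_bounds by (intro U.integrable_const_bound[of _ 1]) auto
  have D_unif: "(LINT u|unif. D ((1 - ratio u) *\<^sub>R z + ratio u *\<^sub>R w)) \<le> \<rho> * D w"
    if "z \<in> S" for z w
  proof -
    have "(LINT u|unif. D ((1 - ratio u) *\<^sub>R z + ratio u *\<^sub>R w)) \<le> (LINT u|unif. ratio u * D w)"
      by (intro integral_mono integrable_unif D_cont D_average that integrable_mult_left int_ratio)
    thus ?thesis by (simp add: \<rho>_def)
  qed
  \<comment> \<open>The first-jump formula with f = D: the expected distance is at most \<rho> times
    its mean over the reflected starting points.\<close>
  have step: "h z \<le> \<rho> * (\<Sum>\<alpha>\<in>A. (\<kappa> \<alpha> / total) * h (refl_in \<alpha> z))" if "z \<in> S" for z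
  proof -
    have "(LINT \<omega>|stream_space steps. LINT u|unif. D ((1 - ratio u) *\<^sub>R z + ratio u *\<^sub>R average y \<omega>))
        \<le> \<rho> * h y" for y
    proof -
      have "(LINT \<omega>|stream_space steps. LINT u|unif. D ((1 - ratio u) *\<^sub>R z + ratio u *\<^sub>R average y \<omega>))
          \<le> (LINT \<omega>|stream_space steps. \<rho> * D (average y \<omega>))"
        by (intro integral_mono' integrable_mult_right integrable_average D_cont D_unif that
            integral_nonneg_AE AE_I2 D_nonneg mult_nonneg_nonneg)
          (auto simp: \<rho>_def ratio_bounds D_nonneg)
      thus ?thesis by (simp add: h_def)
    qed
    hence "h z \<le> (\<Sum>\<alpha>\<in>A. (\<kappa> \<alpha> / total) * (\<rho> * h (refl_in \<alpha> z)))"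
      unfolding h_def[of z] integral_average[OF D_cont] real_scaleR_def
      using nonneg total_pos by (intro sum_mono mult_left_mono) (auto simp: less_imp_le)
    thus ?thesis by (simp add: sum_distrib_left mult_ac)
  qed
  obtain B where B: "\<And>z. z \<in> S \<Longrightarrow> norm z \<le> B"
    using S(1) by (auto simp: bounded_iff)
  \<comment> \<open>Averages and points of S have norm at most B, and S lies in C; this bound makes
    the supremum m below meaningful.\<close>
  have "h z \<le> 2 * B" if "z \<in> S" for z
  proof -
    have "D (average z \<omega>) \<le> 2 * B" for \<omega>
    proof -
      have "D (average z \<omega>) \<le> dist (average z \<omega>) z"
        unfolding D_def using that S(2) by (intro infdist_le) auto
      also have "\<dots> \<le> norm (average z \<omega>) + norm z"
        by (simp add: dist_norm norm_triangle_ineq4)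
      also have "\<dots> \<le> 2 * B"
        using norm_average[of z \<omega>] B[OF that] by simp
      finally show ?thesis .
    qed
    thus ?thesis unfolding h_def
      by (intro S.integral_le_const integrable_average D_cont AE_I2)
  qed
  hence bdd: "bdd_above (h ` S)" by (rule bdd_aboveI2)
  define m where "m = (SUP z\<in>S. h z)"
  have m: "h z \<le> m" if "z \<in> S" for z
    unfolding m_def using bdd that by (rule cSUP_upper2) simp
  have \<rho>_nonneg: "0 \<le> \<rho>"
    unfolding \<rho>_def by (intro integral_nonneg_AE AE_I2 ratio_bounds)
  have "h z \<le> \<rho> * m" if "z \<in> S" for z
  proof -
    have "(\<Sum>\<alpha>\<in>A. (\<kappa> \<alpha> / total) * h (refl_in \<alpha> z)) \<le> (\<Sum>\<alpha>\<in>A. (\<kappa> \<alpha> / total) * m)"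
      using nonneg total_pos invariant[OF that] m
      by (intro sum_mono mult_left_mono) (auto simp: less_imp_le)
    also have "\<dots> = m"
      using total_pos by (simp add: sum_distrib_right[symmetric] sum_divide_distrib[symmetric] total_def)
    finally show ?thesis
      using step[OF that] mult_left_mono[OF _ \<rho>_nonneg] by (meson order_trans)
  qed
  \<comment> \<open>With \<rho> < 1 and 0 \<le> m, this leaves only m = 0.\<close>
  hence "m \<le> \<rho> * m"
    unfolding m_def using \<open>z \<in> S\<close> by (intro cSUP_least) auto
  moreover have "0 \<le> m" using m[OF \<open>z \<in> S\<close>] h_nonneg[of z] by linarith
  moreover have "\<rho> < 1" unfolding \<rho>_def by (rule expectation_ratio)
  ultimately have "m = 0"
    by (metis mult_left_le_one_le mult_less_cancel_right2 not_less order_antisym order.strict_iff_order)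
  hence "h z = 0" using m[OF \<open>z \<in> S\<close>] h_nonneg[of z] by simp
  hence "AE \<omega> in stream_space steps. D (average z \<omega>) = 0"
    unfolding h_def by (subst (asm) integral_nonneg_eq_0_iff_AE)
      (auto intro: integrable_average D_cont D_nonneg)
  thus ?thesis
  proof eventually_elim
    case (elim \<omega>)
    thus ?case
      using C(1) \<open>C \<noteq> {}\<close> by (simp add: D_def in_closed_iff_infdist_zero)
  qed
qed

text \<open>Integration by parts in the waiting time: with y(u) the point in the argument, the
  integrand is the derivative of \<open>total * u * p (y u)\<close>, which is 0 at u = 0 and
  \<open>total * p w\<close> at u = 1.\<close>

lemma integral_unif_hom_poly:
  assumes p: "p \<in> hom_polys n"
  shows "(LINT u|unif. of_real (total + n) * p ((1 - ratio u) *\<^sub>R z + ratio u *\<^sub>R w) -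
      dir_deriv z p ((1 - ratio u) *\<^sub>R z + ratio u *\<^sub>R w)) = of_real total * p w"
proof -
  note poly = hom_polysD(1)[OF p]
  define y where "y u = (1 - ratio u) *\<^sub>R z + ratio u *\<^sub>R w" for u
  define f where "f x = of_real (total + n) * p x - dir_deriv z p x" for x
  have f_cont: "continuous_on UNIV f"
    unfolding f_def
    by (intro continuous_intros continuous_polynomial_function poly polynomial_function_dir_deriv)
  have y_cont: "continuous_on {0..1} y"
    unfolding y_def by (intro continuous_intros continuous_on_ratio)
  have deriv: "((\<lambda>u. of_real (total * u) * p (y u)) has_vector_derivative f (y u)) (at u)"
    if u: "u \<in> {0<..<1}" for u
  proof -
    have "((\<lambda>u. u powr (1 / total)) has_real_derivative 1 / total * u powr (1 / total - 1)) (at u)"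
      using u by (auto intro!: derivative_eq_intros)
    hence "(ratio has_real_derivative 1 / total * u powr (1 / total - 1)) (at u)"
      by (rule has_field_derivative_transform_within_open[of _ _ _ "{0<..<1}"])
        (use u in \<open>auto simp: ratio_eq\<close>)
    moreover have "1 / total * u powr (1 / total - 1) = ratio u / (total * u)"
      using u by (simp add: ratio_eq powr_diff)
    ultimately have ratio: "(ratio has_real_derivative ratio u / (total * u)) (at u)"
      by simp
    have "(y has_vector_derivative (ratio u / (total * u)) *\<^sub>R (w - z)) (at u)"
      unfolding y_def using ratio
      by (auto intro!: derivative_eq_intros simp: algebra_simps)
    \<comment> \<open>Here \<open>ratio u *\<^sub>R (w - z) = y u - z\<close>; splitting this
      direction into y(u) and z lets Euler's identity produce the term n p.\<close>
    hence "(y has_vector_derivative (1 / (total * u)) *\<^sub>R (y u - z)) (at u)"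
      by (simp add: y_def algebra_simps)
    hence "((\<lambda>u. p (y u)) has_derivative
        (\<lambda>t. dir_deriv (t *\<^sub>R ((1 / (total * u)) *\<^sub>R (y u - z))) p (y u))) (at u)"
      unfolding has_vector_derivative_def
      by (rule has_derivative_compose[OF _ has_derivative_dir_deriv[OF poly]])
    moreover have "dir_deriv (t *\<^sub>R ((1 / (total * u)) *\<^sub>R (y u - z))) p (y u) =
        t *\<^sub>R (of_real (1 / (total * u)) * (of_nat n * p (y u) - dir_deriv z p (y u)))" for t
      by (simp add: linear_scale[OF dir_deriv_linear[OF poly]] linear_diff[OF dir_deriv_linear[OF poly]]
          dir_deriv_euler[OF p] scaleR_conv_of_real)
    ultimately have "((\<lambda>u. p (y u)) has_vector_derivative
        of_real (1 / (total * u)) * (of_nat n * p (y u) - dir_deriv z p (y u))) (at u)"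
      by (simp add: has_vector_derivative_def)
    moreover have "((\<lambda>u::real. complex_of_real (total * u)) has_vector_derivative of_real total) (at u)"
      by (auto intro!: derivative_eq_intros simp: has_vector_derivative_def scaleR_conv_of_real)
    ultimately have "((\<lambda>u. of_real (total * u) * p (y u)) has_vector_derivative
        (of_real (total * u) * (of_real (1 / (total * u)) * (of_nat n * p (y u) - dir_deriv z p (y u))) +
          of_real total * p (y u))) (at u)"
      by (intro has_vector_derivative_mult)
    also have "of_real (total * u) * (of_real (1 / (total * u)) * (of_nat n * p (y u) - dir_deriv z p (y u))) +
        of_real total * p (y u) = f (y u)"
      using total_pos u by (simp add: f_def field_simps)
    finally show ?thesis .
  qed
  \<comment> \<open>At the endpoints continuity is enough; the formula for the derivative of
    \<open>ratio\<close> was obtained for 0 < u < 1.\<close>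
  have "((\<lambda>u. f (y u)) has_integral of_real (total * 1) * p (y 1) - of_real (total * 0) * p (y 0)) {0..1}"
    by (rule fundamental_theorem_of_calculus_interior)
      (auto intro!: continuous_intros deriv[simplified]
        continuous_on_compose2[OF continuous_polynomial_function[OF poly] y_cont])
  hence "integral {0..1} (\<lambda>u. f (y u)) = of_real total * p w"
    by (simp add: integral_unique y_def ratio_def)
  moreover have "(LINT u|unif. f (y u)) = integral {0..1} (\<lambda>u. f (y u))"
  proof (rule integral_unif)
    show "continuous_on {0..1} (\<lambda>u. f (y u))"
      by (rule continuous_on_compose2[OF f_cont y_cont]) simp
    have "f \<in> borel_measurable borel"
      by (rule borel_measurable_continuous_onI[OF f_cont])
    thus "(\<lambda>u. f (y u)) \<in> borel_measurable borel"
      unfolding y_def by measurable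
  qed
  ultimately show ?thesis by (simp add: f_def y_def)
qed

section \<open>Moments of the average\<close>

definition moment :: "('a \<Rightarrow> complex) \<Rightarrow> 'a \<Rightarrow> complex" where
  "moment p z = (LINT \<omega>|stream_space steps. p (average z \<omega>))"

text \<open>The first-jump formula is applied to \<open>(total + n) * p - dir_deriv z p\<close>,
  with the direction frozen at the starting point z: the inner integral then collapses to
  \<open>total * p\<close> at the average of the restarted walk.\<close>

lemma moment_recursion:
  assumes p: "p \<in> hom_polys n"
  shows "of_real (total + n) * moment p z =
    (\<Sum>\<alpha>\<in>A. of_real (\<kappa> \<alpha>) * moment p (refl_in \<alpha> z)) + moment (dir_deriv z p) z"
proof -
  note poly = hom_polysD(1)[OF p]
  define f where "f x = of_real (total + n) * p x - dir_deriv z p x" for x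
  have f_cont: "continuous_on UNIV f"
    unfolding f_def
    by (intro continuous_intros continuous_polynomial_function poly polynomial_function_dir_deriv)
  have "of_real (total + n) * moment p z - moment (dir_deriv z p) z =
      (LINT \<omega>|stream_space steps. f (average z \<omega>))"
    unfolding moment_def f_def
    by (subst Bochner_Integration.integral_diff)
      (simp_all add: integrable_average continuous_intros continuous_polynomial_function poly
        polynomial_function_dir_deriv)
  also have "\<dots> = (\<Sum>\<alpha>\<in>A. (\<kappa> \<alpha> / total) *\<^sub>R (LINT \<omega>|stream_space steps.
      of_real total * p (average (refl_in \<alpha> z) \<omega>)))"
    unfolding integral_average[OF f_cont] unfolding f_def integral_unif_hom_poly[OF p] ..
  also have "\<dots> = (\<Sum>\<alpha>\<in>A. of_real (\<kappa> \<alpha>) * moment p (refl_in \<alpha> z))"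
    using total_pos by (simp add: moment_def scaleR_conv_of_real)
  finally show ?thesis by (simp add: algebra_simps)
qed

end

text \<open>A maximum principle on a sphere, which the reflections preserve: the supremum M of |g|
  there satisfies (S + c) M \<le> S M with S = \<open>sum \<kappa> A\<close>, and c > 0 forces M
  \<le> 0.\<close>

lemma bounded_solution_eq_0:
  fixes g :: "'a::euclidean_space \<Rightarrow> complex"
  assumes "finite A" "\<And>\<alpha>. \<alpha> \<in> A \<Longrightarrow> 0 \<le> \<kappa> \<alpha>" "0 < c"
    and bound: "\<And>y. norm y = r \<Longrightarrow> norm (g y) \<le> C"
    and eq: "\<And>y. of_real (sum \<kappa> A + c) * g y = (\<Sum>\<alpha>\<in>A. of_real (\<kappa> \<alpha>) * g (refl_in \<alpha> y))"
    and "norm z = r"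
  shows "g z = 0"
proof -
  define M where "M = (SUP y\<in>{y. norm y = r}. norm (g y))"
  have bdd: "bdd_above ((\<lambda>y. norm (g y)) ` {y. norm y = r})"
    using bound by (auto intro!: bdd_aboveI2)
  have M: "norm (g y) \<le> M" if "norm y = r" for y
    unfolding M_def using bdd that by (intro cSUP_upper) auto
  have nonneg: "0 \<le> sum \<kappa> A"
    using assms(2) by (rule sum_nonneg)
  have "norm (g y) \<le> sum \<kappa> A * M / (sum \<kappa> A + c)" if "norm y = r" for y
  proof -
    have "(sum \<kappa> A + c) * norm (g y) = norm (of_real (sum \<kappa> A + c) * g y)"
      using nonneg \<open>0 < c\<close> unfolding norm_mult norm_of_real by simp
    also have "\<dots> \<le> (\<Sum>\<alpha>\<in>A. norm (of_real (\<kappa> \<alpha>) * g (refl_in \<alpha> y)))"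
      unfolding eq by (rule norm_sum)
    also have "\<dots> \<le> (\<Sum>\<alpha>\<in>A. \<kappa> \<alpha> * M)"
      using assms(2) M that by (intro sum_mono) (simp add: norm_mult mult_left_mono)
    finally have "(sum \<kappa> A + c) * norm (g y) \<le> sum \<kappa> A * M"
      by (simp only: sum_distrib_right)
    thus ?thesis
      using nonneg \<open>0 < c\<close> by (simp add: pos_le_divide_eq mult.commute)
  qed
  hence "M \<le> sum \<kappa> A * M / (sum \<kappa> A + c)"
    unfolding M_def using \<open>norm z = r\<close> by (intro cSUP_least) auto
  hence "c * M \<le> 0"
    using nonneg \<open>0 < c\<close> by (simp add: field_simps)
  hence "M \<le> 0"
    using \<open>0 < c\<close> by (simp add: mult_le_0_iff)
  thus ?thesis
    using M[OF \<open>norm z = r\<close>] by (metis norm_le_zero_iff order_trans)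
qed

section \<open>The intertwiner as an expectation\<close>

lemma hom_polys_0_const:
  assumes "p \<in> hom_polys 0"
  shows "p = (\<lambda>_. p 0)"
proof
  \<comment> \<open>Scaling with t = 0 gives this because \<open>0 ^ 0 = 1\<close>.\<close>
  show "p x = p 0" for x
    using hom_polysD(2)[OF assms, of 0 x] by simp
qed

lemma (in reflection_average) norm_moment_le:
  assumes "continuous_on UNIV p" "\<And>y. norm y \<le> norm z \<Longrightarrow> norm (p y) \<le> C"
  shows "norm (moment p z) \<le> C"
proof -
  interpret S: prob_space "stream_space steps" by (rule prob_space_stream_steps)
  have "norm (moment p z) \<le> (LINT \<omega>|stream_space steps. norm (p (average z \<omega>)))"
    unfolding moment_def by (rule integral_norm_bound)
  also have "\<dots> \<le> C"
    by (intro S.integral_le_const integrable_norm integrable_average assms AE_I2 norm_average)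
  finally show ?thesis .
qed

text \<open>The root \<open>0\<close>, whose reflection is the identity, carries weight 1: it does not affect the
  recursion and makes the total rate positive even if \<open>k = 0\<close>.\<close>
definition jump_rate :: "('a::euclidean_space \<Rightarrow> real) \<Rightarrow> 'a \<Rightarrow> real" where
  "jump_rate k = k(0 := 1)"

lemma jump_rate_simps [simp]: "jump_rate k 0 = 1" "\<alpha> \<noteq> 0 \<Longrightarrow> jump_rate k \<alpha> = k \<alpha>"
  by (simp_all add: jump_rate_def)

lemma reflection_average_jump_rate:
  assumes "finite P" "0 \<notin> P" "\<And>\<alpha>. \<alpha> \<in> P \<Longrightarrow> 0 \<le> k \<alpha>"
  shows "reflection_average (insert 0 P) (jump_rate k)"
proof
  have "sum (jump_rate k) (insert 0 P) = 1 + sum (jump_rate k) P"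
    using assms by simp
  moreover have "0 \<le> sum (jump_rate k) P"
    using assms by (intro sum_nonneg) (auto simp: jump_rate_def)
  ultimately show "0 < sum (jump_rate k) (insert 0 P)" by linarith
qed (use assms in \<open>auto simp: jump_rate_def split: if_splits\<close>)

text \<open>Induction on the degree: \<open>V p\<close> and the moment obey the same recursion,
  whose inhomogeneous part involves only derivatives of p, so their difference solves the equation
  of \<open>bounded_solution_eq_0\<close> with c the degree.\<close>

lemma dunkl_intertwiner_eq_moment:
  assumes P: "finite P" "0 \<notin> P" "\<And>\<alpha>. \<alpha> \<in> P \<Longrightarrow> 0 \<le> k \<alpha>"
    and V: "dunkl_intertwiner P k V"
    and p: "p \<in> hom_polys n"
  shows "V p z = reflection_average.moment (insert 0 P) (jump_rate k) p z"
  using p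
proof (induction n arbitrary: p z)
  interpret reflection_average "insert 0 P" "jump_rate k"
    by (rule reflection_average_jump_rate[OF P])
  interpret S: prob_space "stream_space steps" by (rule prob_space_stream_steps)
  case 0
  have scale: "\<forall>q\<in>polys. \<forall>c. V (\<lambda>x. c * q x) = (\<lambda>x. c * V q x)"
    using V by (simp add: dunkl_intertwiner_def)
  have "V (\<lambda>x. p 0 * 1) = (\<lambda>x. p 0 * V (\<lambda>_. 1) x)"
    using scale[rule_format, of "\<lambda>_. 1" "p 0"] by (simp add: polys_def)
  also have "V (\<lambda>_. 1) = (\<lambda>_. 1)"
    using V unfolding dunkl_intertwiner_def by blast
  finally have "V (\<lambda>_. p 0) z = p 0" by simp
  moreover have "moment (\<lambda>_. p 0) z = p 0"
    by (simp add: moment_def S.prob_space)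
  ultimately show ?case
    using hom_polys_0_const[OF 0] by metis
next
  interpret reflection_average "insert 0 P" "jump_rate k"
    by (rule reflection_average_jump_rate[OF P])
  interpret S: prob_space "stream_space steps" by (rule prob_space_stream_steps)
  case (Suc n)
  note poly = hom_polysD(1)[OF Suc.prems]
  have Vp: "polynomial_function (V p)"
    using V Suc.prems unfolding dunkl_intertwiner_def by (blast dest: hom_polysD(1))
  have "sum (jump_rate k) P = sum k P"
    using P(2) by (intro sum.cong) (auto simp: jump_rate_def)
  hence total: "total = 1 + sum k P"
    using P(1,2) by (simp add: total_def)
  define g where "g y = V p y - moment p y" for y
  have eq: "of_real (sum (jump_rate k) (insert 0 P) + real (Suc n)) * g y =
      (\<Sum>\<alpha>\<in>insert 0 P. of_real (jump_rate k \<alpha>) * g (refl_in \<alpha> y))" for y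
  proof -
    \<comment> \<open>The induction hypothesis applies to each basis derivative; the coefficients
      are constant under the expectation, so the sum reassembles to
      \<open>dir_deriv y p\<close>.\<close>
    have "(\<Sum>b\<in>Basis. of_real (y \<bullet> b) * V (dir_deriv b p) y) =
        (\<Sum>b\<in>Basis. of_real (y \<bullet> b) * moment (dir_deriv b p) y)"
      by (simp add: Suc.IH dir_deriv_hom_polys[OF Suc.prems])
    also have "\<dots> = (LINT \<omega>|stream_space steps. (\<Sum>b\<in>Basis. of_real (y \<bullet> b) * dir_deriv b p (average y \<omega>)))"
      unfolding moment_def
      by (subst Bochner_Integration.integral_sum)
        (simp_all add: integrable_average continuous_polynomial_function continuous_intros
          polynomial_function_dir_deriv poly)
    also have "\<dots> = moment (dir_deriv y p) y"
      by (simp add: moment_def dir_deriv_sum_Basis[OF poly])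
    finally have "of_nat (Suc n) * V p y + (\<Sum>\<alpha>\<in>P. of_real (k \<alpha>) * (V p y - V p (refl_in \<alpha> y))) =
        moment (dir_deriv y p) y"
      using dunkl_intertwiner_recursion[OF V P(1,2) Suc.prems, of y] by simp
    moreover have "(\<Sum>\<alpha>\<in>P. of_real (k \<alpha>) * (V p y - V p (refl_in \<alpha> y))) =
        of_real (sum k P) * V p y - (\<Sum>\<alpha>\<in>P. of_real (k \<alpha>) * V p (refl_in \<alpha> y))"
      by (simp add: right_diff_distrib sum_subtractf sum_distrib_right)
    \<comment> \<open>The zero root contributes f y, matching the summand 1 in
      \<open>total\<close>.\<close>
    moreover have *: "(\<Sum>\<alpha>\<in>insert 0 P. of_real (jump_rate k \<alpha>) * f (refl_in \<alpha> y)) =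
        f y + (\<Sum>\<alpha>\<in>P. of_real (k \<alpha>) * f (refl_in \<alpha> y))" for f :: "'a \<Rightarrow> complex"
      using P(1,2) by (auto simp: jump_rate_def intro!: sum.cong)
    moreover note moment_recursion[OF Suc.prems, of y]
    ultimately show ?thesis
      unfolding total_def[symmetric] *[of g] *[of "moment p"] unfolding g_def
      by (simp add: total algebra_simps sum_subtractf)
  qed
  obtain C1 where C1: "\<And>y. norm y \<le> norm z \<Longrightarrow> norm (p y) \<le> C1"
    using bounded_on_cball[OF continuous_polynomial_function[OF poly]] by blast
  obtain C2 where C2: "\<And>y. norm y \<le> norm z \<Longrightarrow> norm (V p y) \<le> C2"
    using bounded_on_cball[OF continuous_polynomial_function[OF Vp]] by blast
  have "norm (g y) \<le> C2 + C1" if "norm y = norm z" for y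
    unfolding g_def using that
    by (intro order_trans[OF norm_triangle_ineq4] add_mono C2 norm_moment_le
        continuous_polynomial_function poly) (auto intro: C1)
  hence "g z = 0"
    using nonneg by (intro bounded_solution_eq_0[OF fin _ _ _ eq]) auto
  thus ?case by (simp add: g_def)
qed

section \<open>Uniqueness of representing measures\<close>

text \<open>A single homogeneous polynomial lies in \<open>A_space\<close>, where representing
  measures are tested; additivity of the integral extends equality of integrals to these sums, and
  every real polynomial will be shown to be one.\<close>

inductive_set hom_sums :: "('a::euclidean_space \<Rightarrow> complex) set" where
  hom: "p \<in> hom_polys n \<Longrightarrow> p \<in> hom_sums"
| add: "p \<in> hom_sums \<Longrightarrow> q \<in> hom_sums \<Longrightarrow> (\<lambda>x. p x + q x) \<in> hom_sums"

lemma hom_polys_mult: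
  assumes "p \<in> hom_polys m" "q \<in> hom_polys n"
  shows "(\<lambda>x. p x * q x) \<in> hom_polys (m + n)"
proof -
  have "polynomial_function (\<lambda>x. p x * q x)"
  proof -
    have re: "real_polynomial_function (\<lambda>x. Re (f x))" "real_polynomial_function (\<lambda>x. Im (f x))"
      if "polynomial_function f" for f :: "'a \<Rightarrow> complex"
      using that bounded_linear_Re bounded_linear_Im by (auto simp: polynomial_function_def o_def)
    \<comment> \<open>The complex product is written by real and imaginary parts because
      \<open>polynomial_function_mult\<close> multiplies by a real-valued function.\<close>
    have "(\<lambda>x. p x * q x) =
        (\<lambda>x. (Re (p x) * Re (q x) - Im (p x) * Im (q x)) *\<^sub>R 1 +
              (Re (p x) * Im (q x) + Im (p x) * Re (q x)) *\<^sub>R \<i>)"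
      by (simp add: fun_eq_iff complex_eq_iff)
    moreover have "polynomial_function \<dots>"
      using re hom_polysD(1)[OF assms(1)] hom_polysD(1)[OF assms(2)]
      by (intro polynomial_function_add polynomial_function_mult polynomial_function_const)
        (auto simp flip: real_polynomial_function_eq intro!: real_polynomial_function_diff)
    ultimately show ?thesis by simp
  qed
  thus ?thesis
    using hom_polysD(2)[OF assms(1)] hom_polysD(2)[OF assms(2)]
    by (auto simp: hom_polys_def polys_def power_add)
qed

lemma hom_sums_mult:
  assumes "p \<in> hom_sums" "q \<in> hom_sums"
  shows "(\<lambda>x. p x * q x) \<in> hom_sums"
  using assms(1)
proof (induction rule: hom_sums.induct)
  case (hom p m)
  show ?case using assms(2)
  proof (induction rule: hom_sums.induct)
    case (hom q n)
    show ?case by (rule hom_sums.hom[OF hom_polys_mult[OF \<open>p \<in> hom_polys m\<close> hom]])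
  next
    case (add q q')
    show ?case using hom_sums.add[OF add.IH] by (simp add: distrib_left)
  qed
next
  case (add p p')
  show ?case using hom_sums.add[OF add.IH] by (simp add: distrib_right)
qed

text \<open>Linear forms and constants are homogeneous, and the sums are closed under addition and
  multiplication, so induction over the generators replaces a decomposition into monomials.\<close>

lemma real_polynomial_function_hom_sums:
  assumes "real_polynomial_function f"
  shows "(\<lambda>x. of_real (f x)) \<in> hom_sums"
  using assms
proof (induction rule: real_polynomial_function.induct)
  case (linear f)
  note f = linear
  then interpret bounded_linear f .
  have "(\<lambda>x. of_real (f x)) \<in> hom_polys 1"
    using polynomial_function_bounded_linear[OF bounded_linear_compose[OF bounded_linear_of_real f]]
    by (auto simp: hom_polys_def polys_def scaleR)
  thus ?case by (rule hom_sums.hom)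
next
  case (const c)
  have "(\<lambda>x::'a. of_real c) \<in> hom_polys 0"
    by (auto simp: hom_polys_def polys_def)
  thus ?case by (rule hom_sums.hom)
next
  case (add f g)
  thus ?case using hom_sums.add by simp
next
  case (mult f g)
  thus ?case using hom_sums_mult by simp
qed

lemma hom_polys_subset_A_space:
  assumes p: "p \<in> hom_polys n" and "0 \<le> r"
  shows "p \<in> A_space r"
proof -
  define F where "F m = (if m = n then p else (\<lambda>_. 0))" for m
  have "F m \<in> hom_polys m" for m
    using p by (auto simp: F_def hom_polys_def polys_def)
  moreover have "cball (0::'a) r \<noteq> {}" using \<open>0 \<le> r\<close> by simp
  hence "summable (\<lambda>m. SUP y\<in>cball 0 r. norm (F m y))"
    by (intro summable_finite[of "{n}"]) (auto simp: F_def)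
  moreover have "(\<lambda>m. F m y) sums p y" for y
    using sums_single[of n "\<lambda>_. p y"] by (simp add: F_def if_distrib[of "\<lambda>f. f y"] cong: if_cong)
  ultimately show ?thesis
    unfolding A_space_def hom_expansion_def by blast
qed

section \<open>Probability measures on a compact set\<close>

lemma set_integrable_compact:
  fixes f :: "'a::euclidean_space \<Rightarrow> 'b::{banach, second_countable_topology}"
  assumes "borel_prob \<mu>" "compact K" "continuous_on K f"
  shows "set_integrable \<mu> K f"
proof -
  interpret prob_space \<mu> using assms(1) by (simp add: borel_prob_def)
  have [measurable_cong]: "sets \<mu> = sets borel" using assms(1) by (simp add: borel_prob_def)
  have [measurable]: "K \<in> sets borel" using assms(2) by (simp add: borel_compact)
  have [measurable]: "(\<lambda>x. indicator K x *\<^sub>R f x) \<in> borel_measurable borel"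
    using borel_measurable_continuous_on_indicator[OF _ assms(3)] by simp
  obtain C where "\<And>y. y \<in> K \<Longrightarrow> norm (f y) \<le> C"
    using compact_continuous_image[OF assms(3,2)] by (meson bounded_iff compact_imp_bounded imageI)
  hence "norm (indicator K x *\<^sub>R f x) \<le> max C 0" for x
    by (cases "x \<in> K") (auto simp: max.coboundedI1)
  thus ?thesis unfolding set_integrable_def
    by (intro integrable_const_bound[of _ "max C 0"]) auto
qed

text \<open>Stone-Weierstrass passes from polynomials to continuous functions on K, cut-offs of the
  distance pass on to indicators of closed sets, and these sets form an intersection-stable
  generator of the Borel sets.\<close>

lemma borel_prob_eqI:
  fixes \<mu> \<nu> :: "'a::euclidean_space measure"
  assumes \<mu>: "borel_prob \<mu>" "emeasure \<mu> K = 1" and \<nu>: "borel_prob \<nu>" "emeasure \<nu> K = 1"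
    and K: "compact K"
    and eq: "\<And>f. real_polynomial_function f \<Longrightarrow> (LINT x:K|\<mu>. f x) = (LINT x:K|\<nu>. f x)"
  shows "\<mu> = \<nu>"
proof -
  have K_borel[measurable]: "K \<in> sets borel" using K by (simp add: borel_compact)
  have close: "\<bar>(LINT x:K|\<mu>. f x) - (LINT x:K|\<mu>. g x)\<bar> \<le> e"
    if \<mu>: "borel_prob \<mu>" and fg: "continuous_on K f" "continuous_on K g"
      "\<And>x. x \<in> K \<Longrightarrow> \<bar>f x - g x\<bar> \<le> e" and "0 \<le> e"
    for f g :: "'a \<Rightarrow> real" and e and \<mu> :: "'a measure"
  proof -
    interpret prob_space \<mu> using \<mu> by (simp add: borel_prob_def)
    have "(LINT x:K|\<mu>. f x) - (LINT x:K|\<mu>. g x) = (LINT x:K|\<mu>. f x - g x)"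
      using fg \<mu> K by (intro set_integral_diff(2)[symmetric] set_integrable_compact)
    also have "\<bar>\<dots>\<bar> \<le> (LINT x|\<mu>. \<bar>indicator K x *\<^sub>R (f x - g x)\<bar>)"
      unfolding set_lebesgue_integral_def by (rule integral_abs_bound)
    also have "\<dots> \<le> e"
    proof (rule integral_le_const)
      have "set_integrable \<mu> K (\<lambda>x. f x - g x)"
        using fg \<mu> K by (intro set_integrable_compact continuous_on_diff)
      thus "integrable \<mu> (\<lambda>x. \<bar>indicator K x *\<^sub>R (f x - g x)\<bar>)"
        unfolding set_integrable_def by (rule integrable_abs)
      show "AE x in \<mu>. \<bar>indicator K x *\<^sub>R (f x - g x)\<bar> \<le> e"
        using fg(3) \<open>0 \<le> e\<close> by (auto simp: indicator_def)
    qed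
    finally show ?thesis .
  qed
  have cont: "(LINT x:K|\<mu>. f x) = (LINT x:K|\<nu>. f x)" if f: "continuous_on K f" for f :: "'a \<Rightarrow> real"
  proof -
    have "\<bar>(LINT x:K|\<mu>. f x) - (LINT x:K|\<nu>. f x)\<bar> \<le> e" if "0 < e" for e
    proof -
      obtain g where g: "real_polynomial_function g" "\<And>x. x \<in> K \<Longrightarrow> \<bar>f x - g x\<bar> < e / 2"
        using Stone_Weierstrass_real_polynomial_function[OF K f, of "e / 2"] \<open>0 < e\<close> by auto
      have gc: "continuous_on K g"
        using g(1) by (simp add: real_polynomial_function_eq continuous_on_polymonial_function)
      have "\<bar>(LINT x:K|\<mu>. f x) - (LINT x:K|\<mu>. g x)\<bar> \<le> e / 2"
        "\<bar>(LINT x:K|\<nu>. f x) - (LINT x:K|\<nu>. g x)\<bar> \<le> e / 2"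
        using g(2) \<open>0 < e\<close> by (auto intro!: close[OF \<mu>(1) f gc] close[OF \<nu>(1) f gc] simp del: le_divide_eq_numeral1
            intro: less_imp_le)
      with eq[OF g(1)] show ?thesis by linarith
    qed
    thus ?thesis using field_le_epsilon[of "\<bar>(LINT x:K|\<mu>. f x) - (LINT x:K|\<nu>. f x)\<bar>" 0] by simp
  qed
  \<comment> \<open>The cut-offs are 1 on C and eventually vanish at each point outside; the empty
    set is excluded because \<open>infdist\<close> to it is 0.\<close>
  have lim: "(\<lambda>n. LINT x:K|\<mu>. max 0 (1 - real n * infdist x C)) \<longlonglongrightarrow> measure \<mu> C"
    if \<mu>: "borel_prob \<mu>" "emeasure \<mu> K = 1" and C: "closed C" "C \<noteq> {}" for \<mu> and C :: "'a set"
  proof -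
    interpret prob_space \<mu> using \<mu> by (simp add: borel_prob_def)
    have [measurable_cong]: "sets \<mu> = sets borel" using \<mu> by (simp add: borel_prob_def)
    have [measurable]: "C \<in> sets borel" using C by simp
    have [measurable]: "(\<lambda>x. infdist x C) \<in> borel_measurable borel"
      by (intro borel_measurable_continuous_onI continuous_intros)
    have "AE x in \<mu>. x \<in> K"
      using \<mu>(2) by (intro AE_prob_1) (simp add: measure_def)
    hence ae: "AE x in \<mu>. (indicator C x :: real) = indicator K x *\<^sub>R indicator C x"
      by eventually_elim simp
    have "(\<lambda>n. LINT x:K|\<mu>. max 0 (1 - real n * infdist x C)) \<longlonglongrightarrow> (LINT x|\<mu>. indicator K x *\<^sub>R indicator C x)"
      unfolding set_lebesgue_integral_def
    proof (rule integral_dominated_convergence[where w="\<lambda>_. 1"])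
      show "AE x in \<mu>. (\<lambda>n. indicator K x *\<^sub>R max 0 (1 - real n * infdist x C))
          \<longlonglongrightarrow> indicator K x *\<^sub>R indicator C x"
      proof (rule AE_I2, rule tendsto_scaleR[OF tendsto_const])
        fix x
        show "(\<lambda>n. max 0 (1 - real n * infdist x C)) \<longlonglongrightarrow> indicator C x"
        proof (cases "x \<in> C")
          case True
          thus ?thesis by simp
        next
          case False
          hence d: "infdist x C > 0"
            using C in_closed_iff_infdist_zero infdist_nonneg less_eq_real_def by metis
          obtain N where N: "1 / infdist x C < real N" using reals_Archimedean2 by blast
          have "max 0 (1 - real n * infdist x C) = 0" if "n \<ge> N" for n
          proof -
            have "1 / infdist x C \<le> real n" using N that by (smt (verit) of_nat_le_iff)
            thus ?thesis using d by (simp add: field_simps)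
          qed
          hence "\<forall>\<^sub>F n in sequentially. max 0 (1 - real n * infdist x C) = 0"
            using eventually_sequentially by blast
          thus ?thesis using False by (simp add: tendsto_eventually)
        qed
      qed
      show "AE x in \<mu>. norm (indicator K x *\<^sub>R max 0 (1 - real n * infdist x C)) \<le> 1" for n
        by (auto simp: indicator_def infdist_nonneg)
    qed simp_all
    also have "(LINT x|\<mu>. indicator K x *\<^sub>R indicator C x) = (LINT x|\<mu>. (indicator C x :: real))"
      using ae by (intro integral_cong_AE) auto
    also have "\<dots> = measure \<mu> C" by simp
    finally show ?thesis .
  qed
  have closed: "emeasure \<mu> C = emeasure \<nu> C" if "closed C" for C :: "'a set"
  proof (cases "C = {}")
    case False
    have "(LINT x:K|\<mu>. max 0 (1 - real n * infdist x C)) = (LINT x:K|\<nu>. max 0 (1 - real n * infdist x C))" for n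
      by (intro cont continuous_intros)
    hence "measure \<mu> C = measure \<nu> C"
      using LIMSEQ_unique[OF lim[OF \<mu> that False]] lim[OF \<nu> that False] by simp
    thus ?thesis
      using \<mu>(1) \<nu>(1) unfolding borel_prob_def
      by (metis finite_measure.emeasure_eq_measure prob_space_def)
  qed simp
  show ?thesis
  proof (rule measure_eqI_generator_eq[where E="Collect closed" and \<Omega>=UNIV and A="\<lambda>_. UNIV"])
    show "Int_stable (Collect closed)" by (auto simp: Int_stable_def)
    show "sets \<mu> = sigma_sets UNIV (Collect closed)" "sets \<nu> = sigma_sets UNIV (Collect closed)"
      using \<mu>(1) \<nu>(1) by (simp_all add: borel_prob_def borel_eq_closed)
    show "emeasure \<mu> UNIV \<noteq> \<infinity>" for i :: nat
      using \<mu>(1) unfolding borel_prob_def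
      by (metis finite_measure.emeasure_finite infinity_ennreal_def prob_space_def)
  qed (auto intro: closed)
qed

text \<open>Both measures integrate each homogeneous p to \<open>V_ext V (norm x) p x\<close>, hence
  agree on all real polynomials, which determine a measure on the ball.\<close>

lemma representing_measure_unique:
  assumes \<mu>: "representing_measure V x \<mu>" and \<nu>: "representing_measure V x \<nu>"
  shows "\<mu> = \<nu>"
proof -
  let ?K = "cball 0 (norm x)"
  have prob: "borel_prob \<mu>" "borel_prob \<nu>" "emeasure \<mu> ?K = 1" "emeasure \<nu> ?K = 1"
    using \<mu> \<nu> by (auto simp: representing_measure_def)
  have sums: "set_integrable \<mu> ?K p \<and> set_integrable \<nu> ?K p \<and> (LINT y:?K|\<mu>. p y) = (LINT y:?K|\<nu>. p y)"
    if "p \<in> hom_sums" for p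
    using that
  proof (induction rule: hom_sums.induct)
    case (hom p n)
    hence "p \<in> A_space (norm x)" by (intro hom_polys_subset_A_space) auto
    thus ?case using \<mu> \<nu> unfolding representing_measure_def by metis
  next
    case (add p q)
    thus ?case by (simp add: set_integral_add)
  qed
  show ?thesis
  proof (rule borel_prob_eqI[OF prob(1,3,2,4)])
    fix f :: "'a \<Rightarrow> real" assume "real_polynomial_function f"
    from sums[OF real_polynomial_function_hom_sums[OF this]]
    show "(LINT y:?K|\<mu>. f y) = (LINT y:?K|\<nu>. f y)"
      unfolding set_integral_complex_of_real by simp
  qed simp
qed

section \<open>The representing measure\<close>

text \<open>The suprema of the \<open>F n\<close> over the ball are summable, which allows
  integration term by term. The identity holds for any expansion F, in particular for the one chosen
  in \<open>V_ext\<close>.\<close>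

lemma (in reflection_average) moment_hom_expansion:
  assumes F: "hom_expansion (norm x) f F"
  defines "\<mu> \<equiv> distr (stream_space steps) borel (average x)"
  shows "set_integrable \<mu> (cball 0 (norm x)) f"
    and "(\<Sum>n. moment (F n) x) = (LINT \<xi>:cball 0 (norm x)|\<mu>. f \<xi>)"
proof -
  let ?K = "cball 0 (norm x) :: 'a set"
  interpret S: prob_space "stream_space steps" by (rule prob_space_stream_steps)
  interpret M: prob_space \<mu>
    unfolding \<mu>_def by (rule S.prob_space_distr) simp
  have sets_\<mu>: "sets \<mu> = sets borel" by (simp add: \<mu>_def)
  have \<mu>: "borel_prob \<mu>"
    unfolding borel_prob_def using sets_\<mu> M.prob_space_axioms by simp
  have cont: "continuous_on S (F n)" for n S
    using F by (auto simp: hom_expansion_def intro: continuous_polynomial_function hom_polysD(1))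
  define b where "b n = (SUP y\<in>?K. norm (F n y))" for n
  have b: "norm (F n y) \<le> b n" if "y \<in> ?K" for n y
  proof -
    have "compact ((\<lambda>y. norm (F n y)) ` ?K)"
      by (intro compact_continuous_image continuous_on_norm cont) simp
    hence "bdd_above ((\<lambda>y. norm (F n y)) ` ?K)"
      by (simp add: bounded_imp_bdd_above compact_imp_bounded)
    thus ?thesis unfolding b_def using that by (rule cSUP_upper[rotated])
  qed
  have b_nonneg: "0 \<le> b n" for n
    using order_trans[OF norm_ge_zero b[of 0 n]] by simp
  have b_summable: "summable b"
    using F by (simp add: hom_expansion_def b_def[abs_def])
  \<comment> \<open>The series is known to converge to f on the ball only, so each term is cut off
    there.\<close>
  define G where "G n y = indicator ?K y *\<^sub>R F n y" for n y
  have G_bound: "norm (G n y) \<le> b n" for n y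
    using b b_nonneg by (simp add: G_def indicator_def)
  have G_int: "integrable \<mu> (G n)" for n
    using set_integrable_compact[OF \<mu> _ cont, of ?K n]
    by (simp add: set_integrable_def G_def[abs_def])
  have G_summable: "summable (\<lambda>n. norm (G n y))" for y
    by (rule summable_comparison_test'[OF b_summable]) (simp add: G_bound)
  have int_summable: "summable (\<lambda>n. LINT y|\<mu>. norm (G n y))"
  proof (rule summable_comparison_test'[OF b_summable])
    have "(LINT y|\<mu>. norm (G n y)) \<le> b n" for n
      by (intro M.integral_le_const integrable_norm G_int AE_I2 G_bound)
    thus "norm (LINT y|\<mu>. norm (G n y)) \<le> b n" for n by simp
  qed
  have G_suminf: "(\<Sum>n. G n y) = indicator ?K y *\<^sub>R f y" for y
  proof (cases "y \<in> ?K")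
    case True
    hence "(\<lambda>n. F n y) sums f y" using F by (simp add: hom_expansion_def)
    thus ?thesis using True by (simp add: G_def sums_iff)
  qed (simp add: G_def)
  have "integrable \<mu> (\<lambda>y. \<Sum>n. G n y)"
    using G_int G_summable int_summable by (intro integrable_suminf) auto
  thus "set_integrable \<mu> ?K f"
    by (simp add: set_integrable_def G_suminf)
  \<comment> \<open>Averages never leave the ball, so the cut-off does not change the
    expectation.\<close>
  have "moment (F n) x = (LINT y|\<mu>. G n y)" for n
  proof -
    have "G n \<in> borel_measurable borel"
      using borel_measurable_integrable[OF G_int, of n] measurable_cong_sets[OF sets_\<mu> HOL.refl] by blast
    hence "(LINT y|\<mu>. G n y) = (LINT \<omega>|stream_space steps. G n (average x \<omega>))"
      unfolding \<mu>_def by (intro integral_distr) simp_all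
    thus ?thesis
      using norm_average[of x] by (simp add: moment_def G_def)
  qed
  hence "(\<Sum>n. moment (F n) x) = (\<Sum>n. LINT y|\<mu>. G n y)" by simp
  also have "\<dots> = (LINT y|\<mu>. (\<Sum>n. G n y))"
    using G_int G_summable int_summable by (intro integral_suminf[symmetric]) auto
  also have "\<dots> = (LINT \<xi>:?K|\<mu>. f \<xi>)"
    by (simp add: set_lebesgue_integral_def G_suminf)
  finally show "(\<Sum>n. moment (F n) x) = (LINT \<xi>:?K|\<mu>. f \<xi>)" .
qed

lemma representing_measure_distr_average:
  assumes P: "finite P" "0 \<notin> P" "\<And>\<alpha>. \<alpha> \<in> P \<Longrightarrow> 0 \<le> k \<alpha>"
    and V: "dunkl_intertwiner P k V"
  defines "M \<equiv> stream_space (reflection_average.steps (insert 0 P) (jump_rate k))"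
  shows "representing_measure V x (distr M borel (reflection_average.average (insert 0 P) (jump_rate k) x))"
proof -
  interpret reflection_average "insert 0 P" "jump_rate k"
    by (rule reflection_average_jump_rate[OF P])
  interpret S: prob_space "stream_space steps" by (rule prob_space_stream_steps)
  let ?\<mu> = "distr (stream_space steps) borel (average x)"
  have "prob_space ?\<mu>" by (rule S.prob_space_distr) simp
  moreover have "emeasure ?\<mu> (cball 0 (norm x)) = 1"
  proof -
    have "average x -` cball 0 (norm x) \<inter> space (stream_space steps) = space (stream_space steps)"
      using norm_average by auto
    thus ?thesis by (simp add: emeasure_distr S.emeasure_space_1)
  qed
  moreover have "set_integrable ?\<mu> (cball 0 (norm x)) f \<and>
      V_ext V (norm x) f x = (LINT \<xi>:cball 0 (norm x)|?\<mu>. f \<xi>)" if "f \<in> A_space (norm x)" for f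
  proof -
    define F where "F = (SOME F. hom_expansion (norm x) f F)"
    have "\<exists>F. hom_expansion (norm x) f F"
      using that by (simp add: A_space_def)
    hence F: "hom_expansion (norm x) f F"
      unfolding F_def by (rule someI_ex)
    have "V (F n) x = moment (F n) x" for n
      using F by (intro dunkl_intertwiner_eq_moment[OF P V]) (auto simp: hom_expansion_def)
    thus ?thesis
      using moment_hom_expansion[OF F] by (simp add: V_ext_def F_def)
  qed
  ultimately show ?thesis
    unfolding representing_measure_def borel_prob_def M_def by simp
qed

text \<open>The average lies almost surely in the closed convex hull, so the complement of the hull
  is an open null set and contains no point of the support.\<close>

lemma msupport_distr_average:
  assumes P: "finite P" "0 \<notin> P" "\<And>\<alpha>. \<alpha> \<in> P \<Longrightarrow> 0 \<le> k \<alpha>" "P \<subseteq> R"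
  defines "M \<equiv> stream_space (reflection_average.steps (insert 0 P) (jump_rate k))"
  shows "msupport (distr M borel (reflection_average.average (insert 0 P) (jump_rate k) x)) \<subseteq> orbit_hull R x"
proof -
  interpret reflection_average "insert 0 P" "jump_rate k"
    by (rule reflection_average_jump_rate[OF P(1-3)])
  let ?\<mu> = "distr (stream_space steps) borel (average x)" and ?C = "orbit_hull R x"
  \<comment> \<open>The norm condition is kept by reflections and gives boundedness directly,
    without a norm estimate for general elements of \<open>refl_group\<close>.\<close>
  let ?S = "{z \<in> weyl_orbit R x. norm z = norm x}"
  have closed: "closed ?C" by (simp add: orbit_hull_def)
  have "AE \<omega> in stream_space steps. average x \<omega> \<in> ?C"
  proof (rule AE_average_in_convex[where S="?S"])
    show "convex ?C" by (simp add: orbit_hull_def convex_closure)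
    show "bounded ?S" by (auto simp: bounded_iff)
    show "?S \<subseteq> ?C"
      unfolding orbit_hull_def using hull_subset[of "weyl_orbit R x" convex] closure_subset by blast
    show "x \<in> ?S"
      by (auto simp: weyl_orbit_def intro!: exI[of _ id] refl_group.id)
    fix z \<alpha> assume z: "z \<in> ?S" and "\<alpha> \<in> insert 0 P"
    show "refl_in \<alpha> z \<in> ?S"
    proof (cases "\<alpha> = 0")
      case False
      hence "\<alpha> \<in> R" using \<open>\<alpha> \<in> insert 0 P\<close> P(4) by auto
      obtain w where w: "w \<in> refl_group R" "z = w x" using z by (auto simp: weyl_orbit_def)
      have "refl_in \<alpha> \<circ> w \<in> refl_group R"
        by (intro refl_group.comp refl_group.refl \<open>\<alpha> \<in> R\<close> w(1))
      thus ?thesis using z w(2) by (auto simp: weyl_orbit_def intro!: exI[of _ "refl_in \<alpha> \<circ> w"])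
    qed (use z in simp)
  qed (rule closed)
  hence "emeasure (stream_space steps) {\<omega> \<in> space (stream_space steps). average x \<omega> \<notin> ?C} = 0"
    by (intro emeasure_eq_0_AE) simp
  moreover have "average x -` (- ?C) \<inter> space (stream_space steps) =
      {\<omega> \<in> space (stream_space steps). average x \<omega> \<notin> ?C}" by auto
  ultimately have null: "emeasure ?\<mu> (- ?C) = 0"
    using closed by (subst emeasure_distr) simp_all
  have "y \<in> ?C" if y: "y \<in> msupport ?\<mu>" for y
  proof (rule ccontr)
    assume "y \<notin> ?C"
    hence "0 < emeasure ?\<mu> (- ?C)"
      using y closed by (simp add: msupport_def open_Compl)
    with null show False by simp
  qed
  thus ?thesis unfolding M_def by blast
qed

theorem theorem2p1:
  fixes R P :: "'a::euclidean_space set"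
    and k :: "'a \<Rightarrow> real"
    and V :: "('a \<Rightarrow> complex) \<Rightarrow> 'a \<Rightarrow> complex"
    and x :: 'a
  assumes "root_system R"
    and "crystallographic R"
    and "reduced_roots R"
    and "indecomposable R"
    and "positive_subsystem R P"
    and "nonneg_multiplicity R k"
    and "dunkl_intertwiner P k V"
  shows "(\<exists>!\<mu>. representing_measure V x \<mu>) \<and>
         (\<forall>\<mu>. representing_measure V x \<mu> \<longrightarrow> msupport \<mu> \<subseteq> orbit_hull R x)"
proof -
  have "P \<subseteq> R"
    using assms(5) by (auto simp: positive_subsystem_def)
  hence P: "finite P" "0 \<notin> P" "\<And>\<alpha>. \<alpha> \<in> P \<Longrightarrow> 0 \<le> k \<alpha>"
    using assms(1,6) finite_subset by (auto simp: root_system_def nonneg_multiplicity_def)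
  obtain \<mu> where \<mu>: "representing_measure V x \<mu>" "msupport \<mu> \<subseteq> orbit_hull R x"
    using representing_measure_distr_average[where k=k and x=x, OF P assms(7)]
      msupport_distr_average[where k=k and x=x, OF P \<open>P \<subseteq> R\<close>] by blast
  \<comment> \<open>Uniqueness carries the inclusion of the support from the constructed measure to
    every representing measure.\<close>
  hence "\<nu> = \<mu>" if "representing_measure V x \<nu>" for \<nu>
    using that representing_measure_unique by blast
  with \<mu> show ?thesis by blast
qed

end
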